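(* Let $D$ be a division ring with center $Z(D)$, let $g : D \to D$ be an additive map, and let $G_1(Y), G_2(Y), H(Y) \in D_G[Y]$ be such that $G_1(y)\,g(y)\,G_2(y) = H(y)$ for all $y \in D$. If $G_1(Y)$ and $G_2(Y)$ are non-zero in $D_G[Y]$, then either $g$ is an elementary operator or $D$ is finite-dimensional over $Z(D)$.
   Context: Rings are associative with unity. A map $g:D\to D$ is additive if $g(x+y)=g(x)+g(y)$ for all $x,y\in D$. $D_G[Y]$ denotes the generalized free algebra over $Z(D)$ in the variable $Y$ with coefficients in $D$ (i.e. the free product over $Z(D)$ of the $Z(D)$-algebras $D$ and $Z(D)[Y]$); its elements, called generalized polynomials, are finite sums of monomials, a monomial of degree $s$ being of the form $q_1Yq_2Yq_3\cdots q_sYq_{s+1}$ with $q_i\in D$. For $G(Y)\in D_G[Y]$ and $y\in D$, $G(y)\in D$ is obtained by substituting $y$ for $Y$. A map $g:D\to D$ is called an elementary operator if there exist finitely many $p_i,q_i\in D$ such that $g(y)=\sum_i p_i y q_i$ for all $y\in D$. *)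

theory Defs
  imports Complex_Main
begin

section \<open>The center of a division ring, and dimension over it\<close>

typedef (overloaded) ('a::division_ring) center = "{z::'a. \<forall>x. z * x = x * z}"
  morphisms of_center Center
  by (rule exI[of _ 0]) simp

setup_lifting type_definition_center

lemma of_center_commute: "of_center z * x = x * of_center z"
  using of_center[of z] by blast

instantiation center :: (division_ring) field
begin

lift_definition zero_center :: "'a center" is 0 by simp
lift_definition one_center :: "'a center" is 1 by simp
lift_definition plus_center :: "'a center \<Rightarrow> 'a center \<Rightarrow> 'a center" is "(+)"
  by (simp add: algebra_simps)
lift_definition minus_center :: "'a center \<Rightarrow> 'a center \<Rightarrow> 'a center" is "(-)"
  by (simp add: algebra_simps)
lift_definition uminus_center :: "'a center \<Rightarrow> 'a center" is uminus
  by simp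
lift_definition times_center :: "'a center \<Rightarrow> 'a center \<Rightarrow> 'a center" is "(*)"
  by (metis mult.assoc)
lift_definition inverse_center :: "'a center \<Rightarrow> 'a center" is inverse
proof -
  fix z x :: 'a
  assume z: "\<And>x. z * x = x * z"
  show "inverse z * x = x * inverse z"
  proof (cases "z = 0")
    case False
    have "inverse z * x = inverse z * (x * z) * inverse z"
      using False by (simp add: mult.assoc)
    also have "\<dots> = inverse z * (z * x) * inverse z" by (simp only: z)
    also have "\<dots> = x * inverse z"
      using False by (simp add: mult.assoc[symmetric])
    finally show ?thesis .
  qed simp
qed
definition divide_center :: "'a center \<Rightarrow> 'a center \<Rightarrow> 'a center"
  where "divide_center x y = x * inverse y"

instance
proof
  fix a b c :: "'a center"
  show "a + b + c = a + (b + c)" by transfer (rule add.assoc)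
  show "a + b = b + a" by transfer (rule add.commute)
  show "0 + a = a" by transfer simp
  show "- a + a = 0" by transfer simp
  show "a - b = a + - b" by transfer simp
  show "a * b * c = a * (b * c)" by transfer (rule mult.assoc)
  show "a * b = b * a" by transfer blast
  show "1 * a = a" by transfer simp
  show "(a + b) * c = a * c + b * c" by transfer (rule distrib_right)
  show "(0::'a center) \<noteq> 1" by transfer simp
  show "a \<noteq> 0 \<Longrightarrow> inverse a * a = 1" by transfer simp
  show "a div b = a * inverse b" by (rule divide_center_def)
  show "inverse (0::'a center) = 0" by transfer simp
qed

end

definition center_scale :: "'a::division_ring center \<Rightarrow> 'a \<Rightarrow> 'a"
  where "center_scale z x = of_center z * x"

interpretation center: vector_space "center_scale :: 'a::division_ring center \<Rightarrow> 'a \<Rightarrow> 'a"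
  by standard
    (simp_all only: center_scale_def plus_center.rep_eq times_center.rep_eq one_center.rep_eq
      distrib_left distrib_right mult.assoc mult_1_left)

definition finite_dimensional_over_center :: "'a::division_ring itself \<Rightarrow> bool"
  where "finite_dimensional_over_center _ \<longleftrightarrow>
    (\<exists>B. finite_dimensional_vector_space (center_scale :: 'a center \<Rightarrow> 'a \<Rightarrow> 'a) B)"


section \<open>Generalized polynomials\<close>

text \<open>
  The free product over \<open>Z(D)\<close> of the \<open>Z(D)\<close>-algebras \<open>D\<close> and \<open>Z(D)[Y]\<close> is the ring
  generated by (a copy of) \<open>D\<close> and \<open>Y\<close>, subject to the ring axioms, the relations
  making \<open>D \<rightarrow> D\<^sub>G[Y]\<close> a unital ring homomorphism, and centrality of \<open>Z(D)\<close>, for which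
  it is enough that the elements of \<open>Z(D)\<close> commute with \<open>Y\<close>.  It is built
  here as formal ring expressions modulo the congruence generated by these relations;
  the universal property is \<open>gen_poly_universal\<close> below.
\<close>

datatype 'a gen_expr =
    GConst 'a
  | GVar
  | GAdd "'a gen_expr" "'a gen_expr"
  | GMult "'a gen_expr" "'a gen_expr"
  | GNeg "'a gen_expr"

inductive gen_eq :: "'a::division_ring gen_expr \<Rightarrow> 'a gen_expr \<Rightarrow> bool"
where
  gen_eq_refl: "gen_eq p p"
| gen_eq_sym: "gen_eq p q \<Longrightarrow> gen_eq q p"
| gen_eq_trans: "gen_eq p q \<Longrightarrow> gen_eq q r \<Longrightarrow> gen_eq p r"
| gen_eq_add_cong: "gen_eq p p' \<Longrightarrow> gen_eq q q' \<Longrightarrow> gen_eq (GAdd p q) (GAdd p' q')"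
| gen_eq_mult_cong: "gen_eq p p' \<Longrightarrow> gen_eq q q' \<Longrightarrow> gen_eq (GMult p q) (GMult p' q')"
| gen_eq_neg_cong: "gen_eq p p' \<Longrightarrow> gen_eq (GNeg p) (GNeg p')"
| gen_eq_add_assoc: "gen_eq (GAdd (GAdd p q) r) (GAdd p (GAdd q r))"
| gen_eq_add_comm: "gen_eq (GAdd p q) (GAdd q p)"
| gen_eq_add_zero: "gen_eq (GAdd (GConst 0) p) p"
| gen_eq_add_neg: "gen_eq (GAdd (GNeg p) p) (GConst 0)"
| gen_eq_mult_assoc: "gen_eq (GMult (GMult p q) r) (GMult p (GMult q r))"
| gen_eq_mult_one_left: "gen_eq (GMult (GConst 1) p) p"
| gen_eq_mult_one_right: "gen_eq (GMult p (GConst 1)) p"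
| gen_eq_distrib_right: "gen_eq (GMult (GAdd p q) r) (GAdd (GMult p r) (GMult q r))"
| gen_eq_distrib_left: "gen_eq (GMult r (GAdd p q)) (GAdd (GMult r p) (GMult r q))"
| gen_eq_const_add: "gen_eq (GConst (a + b)) (GAdd (GConst a) (GConst b))"
| gen_eq_const_mult: "gen_eq (GConst (a * b)) (GMult (GConst a) (GConst b))"
| gen_eq_center_var: "gen_eq (GMult (GConst (of_center z)) GVar) (GMult GVar (GConst (of_center z)))"

quotient_type (overloaded) 'a gen_poly = "'a::division_ring gen_expr" / gen_eq
  by (rule equivpI) (auto intro: reflpI sympI transpI gen_eq_refl gen_eq_sym gen_eq_trans)

fun gen_expr_eval :: "('a \<Rightarrow> 'b::ring_1) \<Rightarrow> 'b \<Rightarrow> 'a gen_expr \<Rightarrow> 'b"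
where
  "gen_expr_eval \<phi> r (GConst a) = \<phi> a"
| "gen_expr_eval \<phi> r GVar = r"
| "gen_expr_eval \<phi> r (GAdd p q) = gen_expr_eval \<phi> r p + gen_expr_eval \<phi> r q"
| "gen_expr_eval \<phi> r (GMult p q) = gen_expr_eval \<phi> r p * gen_expr_eval \<phi> r q"
| "gen_expr_eval \<phi> r (GNeg p) = - gen_expr_eval \<phi> r p"

definition unital_ring_hom :: "('a::ring_1 \<Rightarrow> 'b::ring_1) \<Rightarrow> bool"
  where "unital_ring_hom \<phi> \<longleftrightarrow>
    (\<forall>a b. \<phi> (a + b) = \<phi> a + \<phi> b) \<and> (\<forall>a b. \<phi> (a * b) = \<phi> a * \<phi> b) \<and> \<phi> 1 = 1"

lemma unital_ring_hom_zero: "unital_ring_hom \<phi> \<Longrightarrow> \<phi> 0 = 0"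
  unfolding unital_ring_hom_def by (metis add_cancel_left_right add_0)

lemma unital_ring_hom_uminus: "unital_ring_hom \<phi> \<Longrightarrow> \<phi> (- a) = - \<phi> a"
  using unital_ring_hom_zero[of \<phi>] unfolding unital_ring_hom_def
  by (metis add.right_inverse add_eq_0_iff)

lemma gen_expr_eval_cong:
  assumes "gen_eq p q" and "unital_ring_hom \<phi>"
    and "\<And>z. \<phi> (of_center z) * r = r * \<phi> (of_center z)"
  shows "gen_expr_eval \<phi> r p = gen_expr_eval \<phi> r q"
proof -
  have zero: "\<phi> 0 = 0" and one: "\<phi> 1 = 1"
    and add: "\<phi> (a + b) = \<phi> a + \<phi> b" and mult: "\<phi> (a * b) = \<phi> a * \<phi> b" for a b
    using assms(2) unital_ring_hom_zero by (auto simp: unital_ring_hom_def)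
  show ?thesis
    using assms(1)
    by induction
      (simp_all add: zero one add mult assms(3) add.assoc mult.assoc distrib_left distrib_right
        add.commute)
qed

lemma unital_ring_hom_id: "unital_ring_hom (\<lambda>x. x)"
  by (simp add: unital_ring_hom_def)

lift_definition gp_const :: "'a::division_ring \<Rightarrow> 'a gen_poly" is GConst .

lift_definition gp_var :: "'a::division_ring gen_poly" is GVar .

lift_definition gp_eval :: "'a::division_ring gen_poly \<Rightarrow> 'a \<Rightarrow> 'a"
  is "\<lambda>p y. gen_expr_eval (\<lambda>x. x) y p"
  by (rule ext, rule gen_expr_eval_cong) (simp_all add: unital_ring_hom_id of_center_commute)

instantiation gen_poly :: (division_ring) ring_1
begin

lift_definition zero_gen_poly :: "'a gen_poly" is "GConst 0" .
lift_definition one_gen_poly :: "'a gen_poly" is "GConst 1" .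
lift_definition plus_gen_poly :: "'a gen_poly \<Rightarrow> 'a gen_poly \<Rightarrow> 'a gen_poly" is GAdd
  by (rule gen_eq_add_cong)
lift_definition times_gen_poly :: "'a gen_poly \<Rightarrow> 'a gen_poly \<Rightarrow> 'a gen_poly" is GMult
  by (rule gen_eq_mult_cong)
lift_definition uminus_gen_poly :: "'a gen_poly \<Rightarrow> 'a gen_poly" is GNeg
  by (rule gen_eq_neg_cong)
definition minus_gen_poly :: "'a gen_poly \<Rightarrow> 'a gen_poly \<Rightarrow> 'a gen_poly"
  where "minus_gen_poly p q = p + - q"

instance
proof
  fix a b c :: "'a gen_poly"
  show "a + b + c = a + (b + c)" by transfer (rule gen_eq_add_assoc)
  show "a + b = b + a" by transfer (rule gen_eq_add_comm)
  show "0 + a = a" by transfer (rule gen_eq_add_zero)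
  show "- a + a = 0" by transfer (rule gen_eq_add_neg)
  show "a - b = a + - b" by (rule minus_gen_poly_def)
  show "a * b * c = a * (b * c)" by transfer (rule gen_eq_mult_assoc)
  show "1 * a = a" by transfer (rule gen_eq_mult_one_left)
  show "a * 1 = a" by transfer (rule gen_eq_mult_one_right)
  show "(a + b) * c = a * c + b * c" by transfer (rule gen_eq_distrib_right)
  show "c * (a + b) = c * a + c * b" by transfer (rule gen_eq_distrib_left)
  have "gp_eval (0 :: 'a gen_poly) 0 \<noteq> gp_eval 1 0" by transfer simp
  then show "(0 :: 'a gen_poly) \<noteq> 1" by auto
qed

end

lemma gp_eval_simps [simp]:
  "gp_eval (gp_const a) y = a"
  "gp_eval gp_var y = y"
  "gp_eval 0 y = 0"
  "gp_eval 1 y = 1"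
  "gp_eval (p + q) y = gp_eval p y + gp_eval q y"
  "gp_eval (p * q) y = gp_eval p y * gp_eval q y"
  "gp_eval (- p) y = - gp_eval p y"
  by (transfer; simp)+

lemma unital_ring_hom_gp_const: "unital_ring_hom gp_const"
  unfolding unital_ring_hom_def
  by (intro conjI allI; transfer)
    (rule gen_eq_const_add gen_eq_const_mult gen_eq_refl)+

lemma gp_const_center_commute_var:
  "gp_const (of_center z) * gp_var = gp_var * gp_const (of_center z)"
  by transfer (rule gen_eq_center_var)

lemma gen_poly_induct [case_names const var add mult uminus, induct type: gen_poly]:
  assumes "\<And>a. P (gp_const a)" and "P gp_var"
    and "\<And>p q. P p \<Longrightarrow> P q \<Longrightarrow> P (p + q)"
    and "\<And>p q. P p \<Longrightarrow> P q \<Longrightarrow> P (p * q)"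
    and "\<And>p. P p \<Longrightarrow> P (- p)"
  shows "P p"
proof -
  have "P (abs_gen_poly e)" for e
    by (induction e)
      (use assms in \<open>auto simp flip: gp_const.abs_eq gp_var.abs_eq plus_gen_poly.abs_eq
        times_gen_poly.abs_eq uminus_gen_poly.abs_eq\<close>)
  then show ?thesis by (metis Quotient_gen_poly Quotient_abs_rep)
qed

lemma gp_const_center_commute: "gp_const (of_center z) * p = p * gp_const (of_center z)"
proof (induction p)
  case (const a)
  show ?case
    using unital_ring_hom_gp_const of_center_commute[of z a]
    unfolding unital_ring_hom_def by metis
next
  case var
  show ?case by (rule gp_const_center_commute_var)
next
  case (add p q)
  then show ?case by (simp add: algebra_simps)
next
  case (mult p q)
  then show ?case by (metis mult.assoc)
next
  case (uminus p)
  then show ?case by simp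
qed

text \<open>
  A \<open>Z(D)\<close>-algebra homomorphism out of \<open>Z(D)[Y]\<close> is the choice of an element \<open>r\<close>, and a
  ring homomorphism \<open>\<phi>\<close> out of \<open>D\<close> restricts to the structure map from \<open>Z(D)\<close>.
\<close>

theorem gen_poly_universal:
  fixes \<phi> :: "'a::division_ring \<Rightarrow> 'b::ring_1" and r :: 'b
  assumes hom: "unital_ring_hom \<phi>"
    and comm: "\<And>z. \<phi> (of_center z) * r = r * \<phi> (of_center z)"
  shows "\<exists>!h. unital_ring_hom h \<and> (\<forall>a. h (gp_const a) = \<phi> a) \<and> h gp_var = r"
proof (rule ex_ex1I)
  define h where "h p = gen_expr_eval \<phi> r (rep_gen_poly p)" for p
  have h: "h (abs_gen_poly e) = gen_expr_eval \<phi> r e" for e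
    unfolding h_def
    by (intro gen_expr_eval_cong hom comm)
      (metis Quotient_gen_poly Quotient_rep_abs gen_eq_refl)
  have abs: "\<exists>e. p = abs_gen_poly e" for p :: "'a gen_poly"
    by (metis Quotient_gen_poly Quotient_abs_rep)
  have "h (p + q) = h p + h q" "h (p * q) = h p * h q" for p q
    using abs[of p] abs[of q]
    by (auto simp: plus_gen_poly.abs_eq times_gen_poly.abs_eq h)
  moreover have "h 1 = 1"
    using hom by (simp add: one_gen_poly.abs_eq h unital_ring_hom_def)
  ultimately have "unital_ring_hom h \<and> (\<forall>a. h (gp_const a) = \<phi> a) \<and> h gp_var = r"
    by (simp add: unital_ring_hom_def gp_const.abs_eq gp_var.abs_eq h)
  then show "\<exists>h. unital_ring_hom h \<and> (\<forall>a. h (gp_const a) = \<phi> a) \<and> h gp_var = r"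
    by (rule exI[of _ h])
next
  fix h k :: "'a gen_poly \<Rightarrow> 'b"
  assume h: "unital_ring_hom h \<and> (\<forall>a. h (gp_const a) = \<phi> a) \<and> h gp_var = r"
    and k: "unital_ring_hom k \<and> (\<forall>a. k (gp_const a) = \<phi> a) \<and> k gp_var = r"
  have "h p = k p" for p
    by (induction p)
      (use h k unital_ring_hom_uminus[of h] unital_ring_hom_uminus[of k] in
        \<open>auto simp: unital_ring_hom_def\<close>)
  then show "h = k" by blast
qed


section \<open>Elementary operators\<close>

definition elementary_operator :: "('a::ring_1 \<Rightarrow> 'a) \<Rightarrow> bool"
  where "elementary_operator g \<longleftrightarrow>
    (\<exists>(n::nat) p q. \<forall>y. g y = (\<Sum>i<n. p i * y * q i))"

end

(*
Assume D has infinite dimension over its center Z.  Work in the D-bimodule of all maps D -> D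
modulo its subbimodule N of generalized polynomial maps.  Replacing y by y + u in the hypothesis
shows that, for all u, the map y |-> G1(y + u) g(y) G2(y + u) lies in N; taking n + m differences
in u, where n and m are the degrees of G1 and G2, removes the occurrences of y + u, so that the
map u |-> G1(u) g G2(u) has degree less than n + m modulo N.

Such an identity forces g to lie in N, by induction on n: if G1 has a summand b Y P(Y), with the
leading coefficients of the other summands linearly independent of b over Z, then
u |-> P(u) g G2(u) has degree less than n - 1 + m modulo N', where N' is N together with
the left D-combinations of elements that commute with D modulo N.  Hence g = sum d_i c_i modulo N
with c_i central and independent modulo N, and the identity splits into the generalized polynomial
identities "G1(u) d_i G2(u) has degree less than n + m" in D, which are impossible by the same peeling
argument.  Leading coefficients can be separated because, by Amitsur's lemma on linearly dependent
values of operators and since a nonzero elementary operator has infinite rank, there is t for which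
the products x t y are as independent as possible.
Finally, a generalized polynomial map that is additive has degree 1, so g is an elementary operator.
*)

theory Submission
  imports Defs "HOL-Library.Function_Algebras"
begin

section \<open>Amitsur's lemma\<close>

text \<open>Induction over the functionals. One that vanishes on the common kernel of the earlier
  ones costs nothing; otherwise a vector \<open>s0\<close> of that kernel on which it is nonzero
  joins \<open>E\<close>, and a multiple of \<open>s0\<close> corrects its value without disturbing
  the others.\<close>

lemma (in vector_space) finite_codim_kernels:
  assumes "finite \<Psi>"
    and add: "\<And>\<psi> x y. \<psi> \<in> \<Psi> \<Longrightarrow> \<psi> (x + y) = \<psi> x + (\<psi> y :: 'a)"
    and scale: "\<And>\<psi> c x. \<psi> \<in> \<Psi> \<Longrightarrow> \<psi> (scale c x) = c * \<psi> x"
  shows "\<exists>E. finite E \<and> (\<forall>s. \<exists>e\<in>span E. \<forall>\<psi>\<in>\<Psi>. \<psi> (s - e) = 0)"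
  using assms
proof (induction \<Psi> rule: finite_induct)
  case empty
  show ?case by (intro exI[of _ "{}"]) auto
next
  case (insert \<psi> \<Psi>)
  have diff: "\<chi> (x - y) = \<chi> x - \<chi> y" if "\<chi> \<in> insert \<psi> \<Psi>" for \<chi> x y
    using insert.prems(1)[OF that, of "x - y" y] by simp
  obtain E where E: "finite E" "\<And>s. \<exists>e\<in>span E. \<forall>\<chi>\<in>\<Psi>. \<chi> (s - e) = 0"
    using insert.IH insert.prems by (metis insertCI)
  show ?case
  proof (cases "\<exists>s0. (\<forall>\<chi>\<in>\<Psi>. \<chi> s0 = 0) \<and> \<psi> s0 \<noteq> 0")
    case True
    then obtain s0 where s0: "\<And>\<chi>. \<chi> \<in> \<Psi> \<Longrightarrow> \<chi> s0 = 0" "\<psi> s0 \<noteq> 0" by blast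
    have "\<exists>e'\<in>span (Set.insert s0 E). \<forall>\<chi>\<in>Set.insert \<psi> \<Psi>. \<chi> (s - e') = 0" for s
    proof -
      obtain e where e: "e \<in> span E" "\<And>\<chi>. \<chi> \<in> \<Psi> \<Longrightarrow> \<chi> (s - e) = 0"
        using E(2)[of s] by blast
      define d where "d = scale (\<psi> (s - e) / \<psi> s0) s0"
      have "\<chi> (s - (e + d)) = 0" if "\<chi> \<in> insert \<psi> \<Psi>" for \<chi>
      proof -
        have "\<chi> (s - (e + d)) = \<chi> (s - e) - \<chi> d"
          using diff[OF that, of "s - e" d] by (simp add: diff_diff_eq)
        moreover have "\<chi> d = (\<psi> (s - e) / \<psi> s0) * \<chi> s0"
          unfolding d_def by (rule insert.prems(2)[OF that])
        ultimately show ?thesis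
          using that s0(1)[of \<chi>] s0(2) e(2)[of \<chi>] by (cases "\<chi> = \<psi>") auto
      qed
      moreover have "e + d \<in> span (Set.insert s0 E)"
        unfolding d_def
        using e(1) span_mono[of E "Set.insert s0 E"]
        by (intro span_add span_scale span_base[of s0]) auto
      ultimately show ?thesis by blast
    qed
    with E(1) show ?thesis by (intro exI[of _ "Set.insert s0 E"]) simp
  next
    case False
    have "\<exists>e\<in>span E. \<forall>\<chi>\<in>Set.insert \<psi> \<Psi>. \<chi> (s - e) = 0" for s
      using E(2)[of s] False by (metis insert_iff)
    with E(1) show ?thesis by blast
  qed
qed

text \<open>Induction on \<open>I\<close>, perturbing the element \<open>t0\<close> found for the
  smaller family. If \<open>T k t0\<close> depends on the other values modulo \<open>span U\<close>,
  the dependence yields an operator \<open>S\<close>. Unless \<open>S\<close> vanishes identically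
  it has infinite rank, so \<open>t0\<close> can be moved by some \<open>s\<close> that
  \<open>S\<close> detects but that is invisible in the finitely many relevant coordinates.\<close>

lemma (in vector_space) amitsur_lemma:
  assumes "finite I" and U: "finite U"
    and add: "\<And>i x y. i \<in> I \<Longrightarrow> T i (x + y) = T i x + T i y"
    and scale: "\<And>i c x. i \<in> I \<Longrightarrow> T i (scale c x) = scale c (T i x)"
    and no_finite_rank: "\<And>c E. finite E \<Longrightarrow> (\<And>t. (\<Sum>i\<in>I. scale (c i) (T i t)) \<in> span E)
      \<Longrightarrow> (\<And>t. (\<Sum>i\<in>I. scale (c i) (T i t)) = 0)"
  shows "\<exists>t. \<forall>c. (\<Sum>i\<in>I. scale (c i) (T i t)) \<in> span U
    \<longrightarrow> (\<forall>s. (\<Sum>i\<in>I. scale (c i) (T i s)) = 0)"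
  using assms(1) add scale no_finite_rank
proof (induction I rule: finite_induct)
  case empty
  show ?case by simp
next
  case (insert k I)
  note add = insert.prems(1) and scale = insert.prems(2) and rank = insert.prems(3)
  define X where "X c t = (\<Sum>i\<in>I. scale (c i) (T i t))" for c t
  have X_add: "X c (x + y) = X c x + X c y" for c x y
    using add by (simp add: X_def scale_right_distrib sum.distrib)
  have X_scale: "X c (scale z x) = scale z (X c x)" for c z x
    using scale by (simp add: X_def scale_sum_right mult.commute)
  have X_comb: "X (\<lambda>i. d i + z * c i) t = X d t + scale z (X c t)" for d c z t
    by (simp add: X_def scale_left_distrib sum.distrib scale_sum_right)
  have split: "(\<Sum>i\<in>insert k I. scale (c i) (T i t)) = scale (c k) (T k t) + X c t" for c t
    using insert.hyps by (simp add: X_def)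
  have "\<exists>t. \<forall>c. X c t \<in> span U \<longrightarrow> (\<forall>s. X c s = 0)"
    unfolding X_def
  proof (rule insert.IH)
    fix c E t
    assume "finite E" and E: "\<And>t. (\<Sum>i\<in>I. scale (c i) (T i t)) \<in> span E"
    have eq: "(\<Sum>i\<in>insert k I. scale ((c(k := 0)) i) (T i t)) = (\<Sum>i\<in>I. scale (c i) (T i t))" for t
      using insert.hyps by (auto intro!: sum.cong)
    show "(\<Sum>i\<in>I. scale (c i) (T i t)) = 0"
      using rank[of E "c(k := 0)"] \<open>finite E\<close> E unfolding eq by blast
  qed (use add scale in auto)
  then obtain t0 where t0: "\<And>c s. X c t0 \<in> span U \<Longrightarrow> X c s = 0" by blast
  show ?case
  proof (cases "\<exists>c. T k t0 - X c t0 \<in> span U")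
    case False
    have "scale (d k) (T k s) + X d s = 0" if *: "scale (d k) (T k t0) + X d t0 \<in> span U" for d s
    proof (cases "d k = 0")
      case True
      then show ?thesis using t0 * by simp
    next
      case dk: False
      have "scale (1 / d k) (scale (d k) (T k t0) + X d t0) \<in> span U"
        using * by (rule span_scale)
      also have "scale (1 / d k) (scale (d k) (T k t0) + X d t0)
          = T k t0 - X (\<lambda>i. 0 + (- 1 / d k) * d i) t0"
        unfolding X_comb using dk by (simp add: scale_right_distrib X_def)
      finally show ?thesis using False by blast
    qed
    then show ?thesis unfolding split by blast
  next
    case True
    then obtain c where c: "T k t0 - X c t0 \<in> span U" by blast
    \<comment> \<open>\<open>T k\<close> is traded for \<open>S\<close>: the family has the same
      linear combinations, but its \<open>k\<close>-th operator now takes a value in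
      \<open>span U\<close> at \<open>t0\<close>.\<close>
    define S where "S t = T k t - X c t" for t
    have S_add: "S (x + y) = S x + S y" for x y
      using add[of k] by (simp add: S_def X_add)
    have S_scale: "S (scale z x) = scale z (S x)" for z x
      using scale[of k] by (simp add: S_def X_scale scale_right_diff_distrib)
    have S: "scale (d k) (T k t) + X d t = X (\<lambda>i. d i + d k * c i) t + scale (d k) (S t)" for d t
      by (simp add: X_comb S_def scale_right_diff_distrib)
    show ?thesis
    proof (cases "\<forall>t. S t = 0")
      case True
      then have "\<forall>d. scale (d k) (T k t0) + X d t0 \<in> span U \<longrightarrow> (\<forall>s. scale (d k) (T k s) + X d s = 0)"
        unfolding S using t0 by simp
      then show ?thesis unfolding split by blast
    next
      case False
      define W where "W = U \<union> (\<lambda>i. T i t0) ` I"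
      have "finite W" using U insert.hyps by (simp add: W_def)
      obtain B where B: "B \<subseteq> W" "independent B" "W \<subseteq> span B"
        using maximal_independent_subset[of W] by blast
      have "finite B" using B \<open>finite W\<close> finite_subset by blast
      have UW: "span U \<subseteq> span B"
        using B(3) W_def by (metis Un_subset_iff span_mono span_span subset_trans)
      have XW: "X d t0 \<in> span B" for d
        unfolding X_def using B(3) by (intro span_sum span_scale) (auto simp: W_def)
      \<comment> \<open>\<open>B\<close> is extended to a basis of the whole space so that the
        coordinates along \<open>B\<close> become functionals defined everywhere.\<close>
      define \<BB> where "\<BB> = extend_basis B"
      have BB: "B \<subseteq> \<BB>" "independent \<BB>" "span \<BB> = UNIV"
        using B(2) by (simp_all add: \<BB>_def extend_basis_superset independent_extend_basis)
      define \<phi> where "\<phi> b x = representation \<BB> x b" for b x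
      have \<phi>_add: "\<phi> b (x + y) = \<phi> b x + \<phi> b y" for b x y
        using BB by (simp add: \<phi>_def representation_add)
      have \<phi>_scale: "\<phi> b (scale z x) = z * \<phi> b x" for b x z
        using BB by (simp add: \<phi>_def representation_scale)
      have \<phi>_sum: "\<phi> b (sum f I) = (\<Sum>i\<in>I. \<phi> b (f i))" for b f
      proof -
        have "\<phi> b 0 = 0" using \<phi>_scale[of b 0 0] by simp
        then show ?thesis using sum_comp_morphism[of "\<phi> b" f I] \<phi>_add by (simp add: comp_def)
      qed
      have \<phi>_zero: "x = 0" if "x \<in> span B" "\<And>b. b \<in> B \<Longrightarrow> \<phi> b x = 0" for x
      proof -
        have "representation \<BB> x = representation B x"
          using BB that by (intro representation_extend) auto
        then have "representation B x b = 0" for b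
          using that(2)[of b] representation_ne_zero[of B x b] by (auto simp: \<phi>_def)
        then show ?thesis
          using sum_nonzero_representation_eq[OF B(2) that(1)] by simp
      qed
      \<comment> \<open>An \<open>s\<close> killed by these functionals moves each
        \<open>T i t0\<close> and \<open>S t0\<close> by vectors without coordinates along
        \<open>B\<close>.\<close>
      define \<Psi> where "\<Psi> = (\<lambda>(b, i). \<lambda>x. \<phi> b (T i x)) ` (B \<times> I) \<union> (\<lambda>b x. \<phi> b (S x)) ` B"
      obtain E where E: "finite E" "\<And>s. \<exists>e\<in>span E. \<forall>\<psi>\<in>\<Psi>. \<psi> (s - e) = 0"
      proof (rule exE[OF finite_codim_kernels[of \<Psi>]])
        show "finite \<Psi>" using \<open>finite B\<close> insert.hyps by (simp add: \<Psi>_def)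
      qed (use add scale in \<open>auto simp: \<Psi>_def \<phi>_add \<phi>_scale S_add S_scale\<close>)
      \<comment> \<open>Otherwise the values of \<open>S\<close> would all be attained on
        \<open>span E\<close>, so \<open>S\<close> would have finite rank and \<open>rank\<close>
        would make it zero.\<close>
      have "\<exists>s. (\<forall>\<psi>\<in>\<Psi>. \<psi> s = 0) \<and> S s \<noteq> 0"
      proof (rule ccontr)
        assume "\<not> ?thesis"
        then have S0: "S s = 0" if "\<And>\<psi>. \<psi> \<in> \<Psi> \<Longrightarrow> \<psi> s = 0" for s using that by blast
        have S_E: "S x \<in> span (S ` E)" if "x \<in> span E" for x
          using that
        proof (induction rule: span_induct_alt)
          case base
          have "S 0 = 0" using S_scale[of 0 0] by simp
          then show ?case by (simp add: span_zero)
        next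
          case (step z x y)
          then show ?case
            by (auto simp: S_add S_scale intro!: span_add span_scale intro: span_base)
        qed
        have "S s \<in> span (S ` E)" for s
        proof -
          obtain e where e: "e \<in> span E" "\<forall>\<psi>\<in>\<Psi>. \<psi> (s - e) = 0" using E(2) by blast
          then have "S (s - e) = 0" using S0 by blast
          then have "S s = S e" using S_add[of "s - e" e] by simp
          then show ?thesis using S_E[OF e(1)] by simp
        qed
        moreover have "(\<Sum>i\<in>insert k I. scale (((\<lambda>i. - c i)(k := 1)) i) (T i s)) = S s" for s
        proof -
          have "X ((\<lambda>i. - c i)(k := 1)) s = - X c s"
            using insert.hyps unfolding X_def sum_negf[symmetric]
            by (intro sum.cong) auto
          then show ?thesis unfolding split by (simp add: S_def fun_upd_def)
        qed
        ultimately have "S s = 0" for s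
          using rank[of "S ` E" "(\<lambda>i. - c i)(k := 1)"] E(1) by (metis finite_imageI)
        with False show False by blast
      qed
      then obtain s where s: "\<And>\<psi>. \<psi> \<in> \<Psi> \<Longrightarrow> \<psi> s = 0" "S s \<noteq> 0" by blast
      have "scale (d k) (T k x) + X d x = 0"
        if *: "scale (d k) (T k (t0 + s)) + X d (t0 + s) \<in> span U" for d x
      proof -
        define e where "e i = d i + d k * c i" for i
        \<comment> \<open>\<open>q\<close> is the contribution of \<open>s\<close>. It lies in
          \<open>span B\<close> and has no coordinates there, so it is zero; what remains is a
          relation at \<open>t0\<close> for the smaller family, to which \<open>t0\<close>
          applies.\<close>
        define q where "q = X e s + scale (d k) (S s)"
        have "X e t0 + scale (d k) (S t0) + q \<in> span U"
          using * unfolding S by (simp add: q_def e_def[abs_def] X_add S_add scale_right_distrib algebra_simps)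
        moreover have St0: "scale (d k) (S t0) \<in> span U"
          using c by (simp add: S_def span_scale)
        ultimately have "(X e t0 + scale (d k) (S t0) + q) - scale (d k) (S t0) \<in> span U"
          by (rule span_diff)
        then have Xq: "X e t0 + q \<in> span U" by simp
        then have "q \<in> span B"
          using UW span_diff[OF _ XW[of e], of "X e t0 + q"] by auto
        moreover have "\<phi> b q = 0" if "b \<in> B" for b
        proof -
          have "\<phi> b (T i s) = 0" if "i \<in> I" for i
            using s(1)[of "\<lambda>x. \<phi> b (T i x)"] \<open>b \<in> B\<close> that by (force simp: \<Psi>_def)
          moreover have "\<phi> b 0 = 0" using \<phi>_scale[of b 0 0] by simp
          ultimately have "\<phi> b (X e s) = 0"
            unfolding X_def \<phi>_sum by (simp add: \<phi>_scale)
          moreover have "\<phi> b (S s) = 0"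
            using s(1)[of "\<lambda>x. \<phi> b (S x)"] \<open>b \<in> B\<close> by (force simp: \<Psi>_def)
          ultimately show ?thesis by (simp add: q_def \<phi>_add \<phi>_scale)
        qed
        ultimately have "q = 0" by (rule \<phi>_zero)
        then have X0: "X e x = 0" for x using Xq t0 by simp
        then have "d k = 0" using \<open>q = 0\<close> s(2) by (simp add: q_def)
        then show ?thesis unfolding S using X0[of x] by (simp add: e_def[abs_def])
      qed
      then show ?thesis unfolding split by blast
    qed
  qed
qed


section \<open>Elementary operators and generic elements\<close>

lemma center_scale_mult:
  "center_scale z x * y = center_scale z (x * y)" "x * center_scale z y = center_scale z (x * y)"
  by (metis center_scale_def mult.assoc of_center_commute)+

section \<open>Closure properties of elementary operators\<close>

lemma elementary_operatorI:
  assumes "finite I"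
  shows "elementary_operator (\<lambda>y. \<Sum>i\<in>I. p i * y * q i)"
proof -
  obtain h where h: "bij_betw h {..<card I} I"
    using assms ex_bij_betw_nat_finite lessThan_atLeast0 by metis
  have "(\<Sum>i\<in>I. p i * y * q i) = (\<Sum>i<card I. p (h i) * y * q (h i))" for y
    using sum.reindex_bij_betw[OF h, of "\<lambda>i. p i * y * q i"] by simp
  then show ?thesis
    unfolding elementary_operator_def
    by (intro exI[of _ "card I"] exI[of _ "p \<circ> h"] exI[of _ "q \<circ> h"]) simp
qed

lemma elementary_operatorE:
  assumes "elementary_operator T"
  obtains n :: nat and p q where "\<And>y. T y = (\<Sum>i<n. p i * y * q i)"
  using assms unfolding elementary_operator_def by blast

lemma elementary_operator_single: "elementary_operator (\<lambda>y. p * y * q)"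
  using elementary_operatorI[of "{()}" "\<lambda>_. p" "\<lambda>_. q"] by simp

lemma elementary_operator_add:
  assumes "elementary_operator S" "elementary_operator T"
  shows "elementary_operator (\<lambda>y. S y + T y)"
proof -
  obtain m :: nat and p q where S: "\<And>y. S y = (\<Sum>i<m. p i * y * q i)"
    using assms(1) by (rule elementary_operatorE) blast
  obtain n :: nat and p' q' where T: "\<And>y. T y = (\<Sum>i<n. p' i * y * q' i)"
    using assms(2) by (rule elementary_operatorE) blast
  have "S y + T y = (\<Sum>i\<in>{..<m} <+> {..<n}. case_sum p p' i * y * case_sum q q' i)" for y
    by (simp add: S T sum.Plus)
  then show ?thesis
    using elementary_operatorI[of "{..<m} <+> {..<n}" "case_sum p p'" "case_sum q q'"] by simp
qed

lemma elementary_operator_sandwich: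
  assumes "elementary_operator S"
  shows "elementary_operator (\<lambda>y. a * S (c * y * d) * b)"
proof -
  obtain n :: nat and p q where S: "\<And>y. S y = (\<Sum>i<n. p i * y * q i)"
    using assms by (rule elementary_operatorE) blast
  have "a * S (c * y * d) * b = (\<Sum>i<n. (a * p i * c) * y * (d * q i * b))" for y
    by (simp add: S sum_distrib_left sum_distrib_right mult.assoc)
  then show ?thesis
    using elementary_operatorI[of "{..<n}" "\<lambda>i. a * p i * c" "\<lambda>i. d * q i * b"] by simp
qed

lemma elementary_operator_linear:
  assumes "elementary_operator S"
  shows "S (x + y) = S x + S y" "S (x - y) = S x - S y" "S (center_scale z x) = center_scale z (S x)"
proof -
  obtain n :: nat and p q where S: "\<And>y. S y = (\<Sum>i<n. p i * y * q i)"
    using assms by (rule elementary_operatorE) blast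
  show "S (x + y) = S x + S y" "S (x - y) = S x - S y"
    by (simp_all add: S algebra_simps sum.distrib sum_subtractf)
  show "S (center_scale z x) = center_scale z (S x)"
    by (simp add: S center_scale_mult center.scale_sum_right)
qed

section \<open>Separating elements by elementary operators\<close>

lemma ex_center:
  assumes "\<And>y. c * y = y * c"
  shows "\<exists>z. c = of_center z"
  using assms Center_inverse[of c] by (intro exI[of _ "Center c"]) auto

text \<open>If no operator separates \<open>b\<close> from \<open>insert a A\<close>, then on the
  operators that kill \<open>A\<close> the value at \<open>b\<close> is the value at
  \<open>a\<close> times a fixed central element \<open>z\<close>. All of them then kill
  \<open>b - center_scale z a\<close>, which contradicts the induction hypothesis.\<close>

lemma artin_whaples:
  assumes "finite A" and "b \<notin> center.span A"
  shows "\<exists>T. elementary_operator T \<and> T b = 1 \<and> (\<forall>a\<in>A. T a = (0::'a::division_ring))"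
  using assms
proof (induction A arbitrary: b rule: finite_induct)
  case empty
  then have "b \<noteq> 0" by simp
  then show ?case
    using elementary_operator_single[of "inverse b" 1] by (intro exI[of _ "\<lambda>y. inverse b * y * 1"]) auto
next
  case (insert a A)
  show ?case
  proof (cases "a \<in> center.span A")
    case True
    then have "b \<notin> center.span A" using insert.prems center.span_redundant by blast
    then obtain T where T: "elementary_operator T" "T b = 1" "\<And>x. x \<in> A \<Longrightarrow> T x = 0"
      using insert.IH by blast
    have "T 0 = 0" using elementary_operator_linear(2)[OF T(1), of 0 0] by simp
    have "T x = 0" if "x \<in> center.span A" for x
      using that
      by (induction rule: center.span_induct_alt)
        (use T(3) \<open>T 0 = 0\<close> in \<open>auto simp: elementary_operator_linear[OF T(1)]\<close>)
    then show ?thesis using T True by blast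
  next
    case False
    then obtain T where T: "elementary_operator T" "T a = 1" "\<And>x. x \<in> A \<Longrightarrow> T x = 0"
      using insert.IH by blast
    show ?thesis
    proof (rule ccontr)
      assume no: "\<not> ?thesis"
      have kill: "S b = 0" if S: "elementary_operator S" "S a = 0" "\<And>x. x \<in> A \<Longrightarrow> S x = 0" for S
      proof (rule ccontr)
        assume "S b \<noteq> 0"
        then show False
          using no elementary_operator_sandwich[OF S(1), of "inverse (S b)" 1 1 1] S(2,3)
          by (auto dest!: spec[of _ "\<lambda>y. inverse (S b) * S (1 * y * 1) * 1"])
      qed
      \<comment> \<open>The operator \<open>\<lambda>y. S y - S a * T y\<close> kills
        \<open>a\<close> as well as \<open>A\<close>, hence also \<open>b\<close>.\<close>
      have Sb: "S b = S a * T b" if S: "elementary_operator S" "\<And>x. x \<in> A \<Longrightarrow> S x = 0" for S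
      proof -
        have "S b + - S a * T b = 0"
          using kill[OF elementary_operator_add[OF S(1)
                elementary_operator_sandwich[OF T(1), of "- S a" 1 1 1]]] S(2) T(2,3)
          by simp
        then show ?thesis by simp
      qed
      \<comment> \<open>Here \<open>Sb\<close> is applied to \<open>T\<close> followed by right
        multiplication by \<open>y\<close>, whose value at \<open>a\<close> is
        \<open>y\<close>.\<close>
      have "T b * y = y * T b" for y
        using Sb[OF elementary_operator_sandwich[OF T(1), of 1 1 1 y]] T(2,3) by simp
      then obtain z where z: "T b = of_center z" using ex_center by blast
      have "b - center_scale z a \<notin> center.span A"
      proof
        assume "b - center_scale z a \<in> center.span A"
        then have "b \<in> center.span (insert a A)"
          unfolding center.span_insert by blast
        with insert.prems show False by blast
      qed
      then obtain S where S: "elementary_operator S" "S (b - center_scale z a) = 1"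
          "\<And>x. x \<in> A \<Longrightarrow> S x = 0"
        using insert.IH by blast
      have "S (b - center_scale z a) = S a * T b - of_center z * S a"
        using Sb[OF S(1,3)] elementary_operator_linear(2)[OF S(1), of b "center_scale z a"]
          elementary_operator_linear(3)[OF S(1), of z a]
        by (simp add: center_scale_def)
      then show False using S(2) z of_center_commute[of z "S a"] by simp
    qed
  qed
qed

section \<open>Bases over the center and operators of finite rank\<close>

lemma finite_dimensional_over_centerI:
  assumes "finite F" and "center.span F = (UNIV :: 'a::division_ring set)"
  shows "finite_dimensional_over_center TYPE('a)"
proof -
  obtain B where B: "B \<subseteq> F" "center.independent B" "F \<subseteq> center.span B"
    using center.maximal_independent_subset[of F] by blast
  have "center.span B = UNIV"
    using B(3) assms(2) by (metis center.span_mono center.span_span top.extremum_uniqueI)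
  then have "finite_dimensional_vector_space (center_scale :: 'a center \<Rightarrow> 'a \<Rightarrow> 'a) B"
    using B assms(1) finite_subset by unfold_locales auto
  then show ?thesis unfolding finite_dimensional_over_center_def by blast
qed

text \<open>One basis is fixed once and for all, so that expansions of different objects can be
  added by merging their index sets.\<close>

definition center_basis :: "'a::division_ring set"
  where "center_basis = center.extend_basis {}"

lemma center_basis: "center.independent center_basis" "center.span center_basis = UNIV"
  by (simp_all add: center_basis_def center.independent_extend_basis center.independent_empty)

lemma center_basis_notin_span: "b \<in> S \<Longrightarrow> S \<subseteq> center_basis \<Longrightarrow> b \<notin> center.span (S - {b})"
  using center_basis(1) center.independent_mono unfolding center.dependent_def by blast

lemma center_basis_expansion:
  obtains S z where "finite S" "S \<subseteq> center_basis" "x = (\<Sum>b\<in>S. center_scale (z b) b)"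
proof -
  have "x \<in> center.span center_basis" by (simp add: center_basis)
  then show ?thesis using that unfolding center.span_explicit by auto
qed

lemma elementary_operator_basis_form:
  assumes "elementary_operator T"
  obtains S q where "finite S" "S \<subseteq> center_basis" "\<And>y. T y = (\<Sum>b\<in>S. b * y * q b)"
proof -
  have "\<exists>S q. finite S \<and> S \<subseteq> center_basis \<and> (\<forall>y. (\<Sum>i<n. p i * y * r i) = (\<Sum>b\<in>S. b * y * q b))"
    for n :: nat and p r :: "nat \<Rightarrow> 'a"
  proof (induction n)
    case 0
    show ?case by (intro exI[of _ "{}"]) simp
  next
    case (Suc n)
    then obtain S q where S: "finite S" "S \<subseteq> center_basis"
      "\<And>y. (\<Sum>i<n. p i * y * r i) = (\<Sum>b\<in>S. b * y * q b)" by blast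
    obtain S' z where S': "finite S'" "S' \<subseteq> center_basis" "p n = (\<Sum>b\<in>S'. center_scale (z b) b)"
      by (rule center_basis_expansion)
    have "(\<Sum>i<Suc n. p i * y * r i) = (\<Sum>b\<in>S \<union> S'. b * y *
        ((if b \<in> S then q b else 0) + (if b \<in> S' then center_scale (z b) (r n) else 0)))" for y
    proof -
      have "(\<Sum>b\<in>S. b * y * q b) = (\<Sum>b\<in>S \<union> S'. b * y * (if b \<in> S then q b else 0))"
        using S(1) S'(1) by (intro sum.mono_neutral_cong_left) auto
      moreover have "p n * y * r n
          = (\<Sum>b\<in>S \<union> S'. b * y * (if b \<in> S' then center_scale (z b) (r n) else 0))"
        unfolding S'(3) sum_distrib_right using S(1) S'(1)
        by (intro sum.mono_neutral_cong_left) (auto simp: center_scale_mult)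
      ultimately show ?thesis using S(3) by (simp add: distrib_left sum.distrib)
    qed
    then show ?case using S S' by (intro exI[of _ "S \<union> S'"] exI conjI allI) auto
  qed
  note basis_form = this
  obtain n :: nat and p r where T: "\<And>y. T y = (\<Sum>i<n. p i * y * r i)"
    using assms by (rule elementary_operatorE) blast
  show ?thesis using basis_form[of p r n] that unfolding T by blast
qed

lemma span_mult:
  assumes "x \<in> center.span E"
  shows "a * x * b \<in> center.span ((\<lambda>e. a * e * b) ` E)"
  using assms
proof (induction rule: center.span_induct_alt)
  case base
  show ?case by (simp add: center.span_zero)
next
  case (step z x y)
  then show ?case
    by (auto simp: distrib_left distrib_right center_scale_mult
        intro!: center.span_add center.span_scale intro: center.span_base)
qed

text \<open>Once the left factors are linearly independent, one summand of \<open>T\<close> can be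
  isolated by multiplications from both sides. This recovers every \<open>y\<close> from finitely
  many values of \<open>T\<close>, so a finite-dimensional range forces \<open>D\<close> to be
  finite-dimensional.\<close>

lemma finite_rank_elementary_operator:
  fixes T :: "'a::division_ring \<Rightarrow> 'a"
  assumes T: "elementary_operator T" and "T y0 \<noteq> 0"
    and E: "finite E" "\<And>y. T y \<in> center.span E"
  shows "finite_dimensional_over_center TYPE('a)"
proof -
  obtain S q where S: "finite S" "S \<subseteq> center_basis" "\<And>y. T y = (\<Sum>b\<in>S. b * y * q b)"
    using T by (rule elementary_operator_basis_form) blast
  obtain b where b: "b \<in> S" "q b \<noteq> 0"
    using \<open>T y0 \<noteq> 0\<close> unfolding S(3) by (force intro: sum.neutral)
  obtain P where P: "elementary_operator P" "P b = 1" "\<And>a. a \<in> S - {b} \<Longrightarrow> P a = 0"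
    using artin_whaples[OF _ center_basis_notin_span[OF b(1) S(2)]] S(1) by blast
  obtain n :: nat and p r where P': "\<And>y. P y = (\<Sum>i<n. p i * y * r i)"
    using P(1)
    by (rule elementary_operatorE) blast
  define E' where "E' = (\<Union>i<n. (\<lambda>e. p i * e * inverse (q b)) ` E)"
  have "y \<in> center.span E'" for y
  proof -
    \<comment> \<open>Inserting \<open>r i\<close> before \<open>y\<close> and \<open>p i\<close> in
      front turns each left factor \<open>a\<close> of \<open>T\<close> into \<open>P a\<close>,
      which is 1 for \<open>b\<close> and 0 for the others.\<close>
    have "(\<Sum>i<n. p i * T (r i * y) * inverse (q b)) = (\<Sum>a\<in>S. P a * y * q a) * inverse (q b)"
      unfolding S(3) P' sum_distrib_left sum_distrib_right
      by (subst sum.swap) (simp add: mult.assoc)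
    also have "(\<Sum>a\<in>S. P a * y * q a) = (\<Sum>a\<in>S. if a = b then y * q b else 0)"
      using P(2,3) by (intro sum.cong) auto
    finally have "(\<Sum>i<n. p i * T (r i * y) * inverse (q b)) = y"
      using b S(1) by (simp add: mult.assoc)
    moreover have "p i * T (r i * y) * inverse (q b) \<in> center.span E'" if "i < n" for i
      using that by (intro subsetD[OF center.span_mono span_mult[OF E(2)]]) (auto simp: E'_def)
    ultimately show ?thesis by (metis (no_types, lifting) center.span_sum lessThan_iff)
  qed
  then show ?thesis
    using E(1) by (intro finite_dimensional_over_centerI[of E']) (auto simp: E'_def)
qed

section \<open>Generic elements\<close>

text \<open>
  The conclusion is the vanishing of the operator, not only of its value at \<open>t\<close>; this is what
  makes genericity stable under translation (\<open>generic_shift\<close>).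
\<close>

definition generic :: "'a::division_ring set \<Rightarrow> 'a \<Rightarrow> bool"
  where "generic F t \<longleftrightarrow> (\<forall>c. (\<Sum>(x, y)\<in>F \<times> F. center_scale (c x y) (x * t * y)) \<in> center.span F
    \<longrightarrow> (\<forall>s. (\<Sum>(x, y)\<in>F \<times> F. center_scale (c x y) (x * s * y)) = 0))"

text \<open>This is \<open>amitsur_lemma\<close> for the operators sending \<open>t\<close> to
  \<open>x * t * y\<close>. Its rank condition holds because a nonzero elementary operator of finite
  rank would make \<open>D\<close> finite-dimensional.\<close>

lemma generic_exists:
  fixes F :: "'a::division_ring set"
  assumes "\<not> finite_dimensional_over_center TYPE('a)" and "finite F"
  shows "\<exists>t. generic F t"
proof -
  let ?T = "\<lambda>(x, y) t. x * t * y :: 'a"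
  have "\<exists>t. \<forall>c. (\<Sum>i\<in>F \<times> F. center_scale (c i) (?T i t)) \<in> center.span F
    \<longrightarrow> (\<forall>s. (\<Sum>i\<in>F \<times> F. center_scale (c i) (?T i s)) = 0)"
  proof (rule center.amitsur_lemma)
    fix c :: "'a \<times> 'a \<Rightarrow> 'a center" and E t
    assume E: "finite E" "\<And>t. (\<Sum>i\<in>F \<times> F. center_scale (c i) (?T i t)) \<in> center.span E"
    have "elementary_operator (\<lambda>t. \<Sum>i\<in>F \<times> F. center_scale (c i) (?T i t))"
      using elementary_operatorI[of "F \<times> F" "\<lambda>i. center_scale (c i) (fst i)" snd] \<open>finite F\<close>
      by (simp add: case_prod_unfold center_scale_mult)
    then show "(\<Sum>i\<in>F \<times> F. center_scale (c i) (?T i t)) = 0"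
      using finite_rank_elementary_operator assms(1) E by blast
  qed (use \<open>finite F\<close> in \<open>auto simp: distrib_left distrib_right center_scale_mult\<close>)
  then obtain t where t: "\<And>c s. (\<Sum>i\<in>F \<times> F. center_scale (c i) (?T i t)) \<in> center.span F
    \<Longrightarrow> (\<Sum>i\<in>F \<times> F. center_scale (c i) (?T i s)) = 0" by blast
  have "generic F t"
    unfolding generic_def using t[of "\<lambda>(x, y). c x y" for c] by (simp add: case_prod_unfold)
  then show ?thesis by blast
qed

lemma generic_mono:
  assumes "generic F' t" "F \<subseteq> F'" "finite F'"
  shows "generic F t"
  unfolding generic_def
proof (intro allI impI)
  fix c s
  assume *: "(\<Sum>(x, y)\<in>F \<times> F. center_scale (c x y) (x * t * y)) \<in> center.span F"
  define c' where "c' x y = (if x \<in> F \<and> y \<in> F then c x y else 0)" for x y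
  have c': "(\<Sum>(x, y)\<in>F \<times> F. center_scale (c x y) (x * r * y))
      = (\<Sum>(x, y)\<in>F' \<times> F'. center_scale (c' x y) (x * r * y))" for r
    using assms(2,3) by (intro sum.mono_neutral_cong_left) (auto simp: c'_def split: if_splits)
  then show "(\<Sum>(x, y)\<in>F \<times> F. center_scale (c x y) (x * s * y)) = 0"
    using * assms(1) center.span_mono[OF assms(2)] unfolding generic_def c' by blast
qed

text \<open>Passing from \<open>t\<close> to \<open>t + s\<close> changes a combination of the
  products by an element of the span of all \<open>x * s * y\<close>; adding these to
  \<open>F\<close> absorbs the change. The lemma serves to write any \<open>s\<close> as a
  difference of two generic elements.\<close>

lemma generic_shift:
  assumes "finite F"
  shows "\<exists>F'. finite F' \<and> (\<forall>t. generic F' t \<longrightarrow> generic F t \<and> generic F (t + s))"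
proof -
  define F' where "F' = F \<union> (\<lambda>(x, y). x * s * y) ` (F \<times> F)"
  have F': "finite F'" "F \<subseteq> F'" using assms by (auto simp: F'_def)
  have "generic F (t + s)" if t: "generic F' t" for t
    unfolding generic_def
  proof (intro allI impI)
    fix c r
    assume *: "(\<Sum>(x, y)\<in>F \<times> F. center_scale (c x y) (x * (t + s) * y)) \<in> center.span F"
    define c' where "c' x y = (if x \<in> F \<and> y \<in> F then c x y else 0)" for x y
    have c': "(\<Sum>(x, y)\<in>F \<times> F. center_scale (c x y) (x * r * y))
        = (\<Sum>(x, y)\<in>F' \<times> F'. center_scale (c' x y) (x * r * y))" for r
      using F' by (intro sum.mono_neutral_cong_left) (auto simp: c'_def split: if_splits)
    have split: "(\<Sum>(x, y)\<in>F \<times> F. center_scale (c x y) (x * (t + s) * y))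
      = (\<Sum>(x, y)\<in>F \<times> F. center_scale (c x y) (x * t * y))
        + (\<Sum>(x, y)\<in>F \<times> F. center_scale (c x y) (x * s * y))"
      by (simp add: case_prod_unfold sum.distrib[symmetric] distrib_left distrib_right
          center.scale_right_distrib)
    have s: "(\<Sum>(x, y)\<in>F \<times> F. center_scale (c x y) (x * s * y)) \<in> center.span F'"
      by (intro center.span_sum) (clarify, intro center.span_scale center.span_base, auto simp: F'_def)
    have ts: "(\<Sum>(x, y)\<in>F \<times> F. center_scale (c x y) (x * (t + s) * y)) \<in> center.span F'"
      using * F'(2) center.span_mono by blast
    have "(\<Sum>(x, y)\<in>F \<times> F. center_scale (c x y) (x * t * y)) \<in> center.span F'"
      using ts unfolding split center.span_add_eq2[OF s] .
    then show "(\<Sum>(x, y)\<in>F \<times> F. center_scale (c x y) (x * r * y)) = 0"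
      using t unfolding generic_def c' by blast
  qed
  then show ?thesis using F' generic_mono by blast
qed

text \<open>A dependence of \<open>b\<close> would put a combination of products
  \<open>x * t * y\<close> into \<open>center.span F\<close>. Genericity makes that combination
  zero, which leaves \<open>b\<close> in \<open>center.span A\<close>. The products in question are
  the leading coefficients that taking a difference creates.\<close>

lemma generic_span:
  assumes t: "generic F t" and "finite F" "A \<subseteq> F" "X \<subseteq> F" "Y \<subseteq> F" "b \<in> F"
    and b: "b \<notin> center.span A"
  shows "b \<notin> center.span (A \<union> {x * t * y | x y. x \<in> X \<and> y \<in> Y})"
proof
  let ?Q = "\<lambda>c. \<Sum>(x, y)\<in>F \<times> F. center_scale (c x y) (x * t * y)"
  assume "b \<in> center.span (A \<union> {x * t * y | x y. x \<in> X \<and> y \<in> Y})"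
  then obtain a v where av: "b = a + v" "a \<in> center.span A"
      "v \<in> center.span {x * t * y | x y. x \<in> X \<and> y \<in> Y}"
    unfolding center.span_Un by blast
  from av(3) have "\<exists>c. v = ?Q c"
  proof (induction rule: center.span_induct_alt)
    case base
    show ?case by (rule exI[of _ "\<lambda>_ _. 0"]) simp
  next
    case (step z u w)
    then obtain x y c where xy: "u = x * t * y" "x \<in> F" "y \<in> F" and c: "w = ?Q c"
      using assms(4,5) by blast
    define d where "d x' y' = (if (x', y') = (x, y) then z else 0)" for x' y'
    have "?Q d = (\<Sum>p\<in>F \<times> F. if p = (x, y) then center_scale z (x * t * y) else 0)"
      by (intro sum.cong) (auto simp: d_def split: if_splits)
    also have "\<dots> = center_scale z u"
      using xy \<open>finite F\<close> by simp
    finally have "center_scale z u + w = ?Q (\<lambda>x y. d x y + c x y)"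
      by (simp add: c case_prod_unfold sum.distrib center.scale_left_distrib)
    then show ?case by (rule exI[of _ "\<lambda>x y. d x y + c x y"])
  qed
  then obtain c where c: "v = ?Q c" by blast
  have "v = b - a" using av(1) by simp
  moreover have "b - a \<in> center.span F"
    using av(2) center.span_mono[OF assms(3)] \<open>b \<in> F\<close>
    by (intro center.span_diff center.span_base[of b]) auto
  ultimately have "?Q c \<in> center.span F" using c by simp
  then have "v = 0" using t c unfolding generic_def by blast
  then show False using av b by simp
qed


section \<open>Degrees of bimodule-valued maps\<close>

definition fdiff :: "'a::plus \<Rightarrow> ('a \<Rightarrow> 'v::minus) \<Rightarrow> 'a \<Rightarrow> 'v"
  where "fdiff t f = (\<lambda>u. f (u + t) - f u)"

primrec degree_less :: "nat \<Rightarrow> ('a::ab_group_add \<Rightarrow> 'v::ab_group_add) \<Rightarrow> bool"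
where
  "degree_less 0 f \<longleftrightarrow> (\<forall>u. f u = 0)"
| "degree_less (Suc n) f \<longleftrightarrow> (\<forall>t. degree_less n (fdiff t f))"

text \<open>
  Requiring the difference only for generic \<open>t\<close> makes the induction in \<open>peel_left\<close> possible:
  there the leading coefficients stay separated only for generic \<open>t\<close>.
\<close>

primrec generic_degree_less :: "'v set \<Rightarrow> nat \<Rightarrow> ('a::division_ring \<Rightarrow> 'v::ab_group_add) \<Rightarrow> bool"
where
  "generic_degree_less N 0 f \<longleftrightarrow> (\<forall>u. f u \<in> N)"
| "generic_degree_less N (Suc n) f \<longleftrightarrow>
    (\<exists>F. finite F \<and> (\<forall>t. generic F t \<longrightarrow> generic_degree_less N n (fdiff t f)))"

lemma fdiff_add: "fdiff t (\<lambda>u. f u + g u) = (\<lambda>u. fdiff t f u + (fdiff t g u :: 'v::ab_group_add))"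
  by (simp add: fdiff_def algebra_simps)

lemma fdiff_shift: "fdiff t (\<lambda>u. f (u + s)) = (\<lambda>u. fdiff t f (u + (s :: 'a::ab_semigroup_add)))"
  by (simp add: fdiff_def add.assoc add.commute[of s])

lemma degree_less_add:
  "degree_less n f \<Longrightarrow> degree_less n g \<Longrightarrow> degree_less n (\<lambda>u. f u + g u)"
  by (induction n arbitrary: f g) (auto simp: fdiff_add)

lemma degree_less_zero: "degree_less n (\<lambda>u. 0)"
  by (induction n) (auto simp: fdiff_def)

lemma degree_less_Suc: "degree_less n f \<Longrightarrow> degree_less (Suc n) f"
  by (induction n arbitrary: f) (auto simp: fdiff_def)

lemma degree_less_mono: "m \<le> n \<Longrightarrow> degree_less m f \<Longrightarrow> degree_less n f"
  by (induction rule: dec_induct) (auto intro: degree_less_Suc simp del: degree_less.simps)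

lemma degree_less_1_const: "degree_less (Suc 0) f \<longleftrightarrow> (\<forall>u. f u = f 0)"
proof
  assume "degree_less (Suc 0) f"
  then have "fdiff u f 0 = 0" for u by simp
  then show "\<forall>u. f u = f 0" by (simp add: fdiff_def)
next
  assume *: "\<forall>u. f u = f 0"
  have "f (u + t) = f u" for u t using *[rule_format, of "u + t"] *[rule_format, of u] by simp
  then show "degree_less (Suc 0) f" by (simp add: fdiff_def)
qed

lemma degree_less_const: "degree_less (Suc n) (\<lambda>_. v)"
  by (rule degree_less_mono[of 1]) (auto simp: degree_less_1_const simp del: degree_less.simps)

lemma degree_less_compose:
  assumes "\<And>v w. h (v + w) = h v + (h w :: 'w::ab_group_add)" "degree_less n f"
  shows "degree_less n (\<lambda>u. h (f u :: 'v::ab_group_add))"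
  using assms(2)
proof (induction n arbitrary: f)
  case 0
  have "h 0 = 0" using assms(1)[of 0 0] by simp
  with 0 show ?case by simp
next
  case (Suc n)
  have "h (v - w) = h v - h w" for v w
    using assms(1)[of "v - w" w] by simp
  then have "fdiff t (\<lambda>u. h (f u)) = (\<lambda>u. h (fdiff t f u))" for t
    by (simp add: fdiff_def)
  with Suc show ?case by simp
qed

lemma generic_degree_less_compose:
  assumes "\<And>v w. h (v + w) = h v + (h w :: 'w::ab_group_add)" "\<And>v. v \<in> N \<Longrightarrow> h v \<in> N'"
    and "generic_degree_less N n f"
  shows "generic_degree_less N' n (\<lambda>u. h (f u :: 'v::ab_group_add))"
  using assms(3)
proof (induction n arbitrary: f)
  case 0
  then show ?case using assms(2) by simp
next
  case (Suc n)
  have "h (v - w) = h v - h w" for v w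
    using assms(1)[of "v - w" w] by simp
  then have "fdiff t (\<lambda>u. h (f u)) = (\<lambda>u. h (fdiff t f u))" for t
    by (simp add: fdiff_def)
  moreover obtain F where "finite F" "\<And>t. generic F t \<Longrightarrow> generic_degree_less N n (fdiff t f)"
    using Suc.prems by auto
  ultimately show ?case using Suc.IH by auto
qed

section \<open>Bimodules over \<open>D\<close> and maps of controlled top degree\<close>

locale bimodule =
  fixes L R :: "'a::division_ring \<Rightarrow> 'v::ab_group_add \<Rightarrow> 'v"
  assumes L_add_right: "L a (v + w) = L a v + L a w"
    and L_add_left: "L (a + b) v = L a v + L b v"
    and L_mult: "L (a * b) v = L a (L b v)"
    and L_one: "L 1 v = v"
    and R_add_right: "R a (v + w) = R a v + R a w"
    and R_add_left: "R (a + b) v = R a v + R b v"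
    and R_mult: "R (a * b) v = R b (R a v)"
    and R_one: "R 1 v = v"
    and L_R: "L a (R b v) = R b (L a v)"
begin

lemma zero [simp]: "L a 0 = 0" "R a 0 = 0" "L 0 v = 0" "R 0 v = 0"
  using L_add_right[of a 0 0] R_add_right[of a 0 0] L_add_left[of 0 0 v] R_add_left[of 0 0 v]
  by simp_all

lemma minus: "L (- a) v = - L a v" "R (- a) v = - R a v"
  using L_add_left[of a "- a" v] R_add_left[of a "- a" v]
  by (simp_all add: eq_neg_iff_add_eq_0 add.commute)

lemma diff: "L a (v - w) = L a v - L a w" "R a (v - w) = R a v - R a w"
  using L_add_right[of a "v - w" w] R_add_right[of a "v - w" w] by simp_all

lemma sum: "L a (\<Sum>i\<in>I. f i) = (\<Sum>i\<in>I. L a (f i))" "R a (\<Sum>i\<in>I. f i) = (\<Sum>i\<in>I. R a (f i))"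
  using sum_comp_morphism[of "L a" f I] sum_comp_morphism[of "R a" f I]
  by (simp_all add: L_add_right R_add_right comp_def)

lemma sum_left: "L (\<Sum>i\<in>I. g i) v = (\<Sum>i\<in>I. L (g i) v)" "R (\<Sum>i\<in>I. g i) v = (\<Sum>i\<in>I. R (g i) v)"
  using sum_comp_morphism[of "\<lambda>a. L a v" g I] sum_comp_morphism[of "\<lambda>a. R a v" g I]
  by (simp_all add: L_add_left R_add_left comp_def)

definition subbimodule :: "'v set \<Rightarrow> bool"
  where "subbimodule N \<longleftrightarrow> 0 \<in> N \<and> (\<forall>v\<in>N. \<forall>w\<in>N. v + w \<in> N)
    \<and> (\<forall>a. \<forall>v\<in>N. L a v \<in> N \<and> R a v \<in> N)"

lemma subbimoduleD:
  assumes "subbimodule N"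
  shows "0 \<in> N" "v \<in> N \<Longrightarrow> w \<in> N \<Longrightarrow> v + w \<in> N" "v \<in> N \<Longrightarrow> L a v \<in> N" "v \<in> N \<Longrightarrow> R a v \<in> N"
    "v \<in> N \<Longrightarrow> - v \<in> N" "v \<in> N \<Longrightarrow> w \<in> N \<Longrightarrow> v - w \<in> N"
proof -
  show neg: "- v \<in> N" if "v \<in> N" for v
    using assms that minus(1)[of 1 v] L_one[of v] unfolding subbimodule_def by metis
  show "v - w \<in> N" if "v \<in> N" "w \<in> N"
    using assms neg that unfolding subbimodule_def diff_conv_add_uminus by blast
qed (use assms in \<open>auto simp: subbimodule_def\<close>)

lemma subbimodule_sum:
  "subbimodule N \<Longrightarrow> (\<And>i. i \<in> I \<Longrightarrow> f i \<in> N) \<Longrightarrow> (\<Sum>i\<in>I. f i) \<in> N"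
  by (induction I rule: infinite_finite_induct) (auto simp: subbimoduleD)

text \<open>Product rule for differences. The last term is a correction of smaller degree than the
  bound for the other two; the middle one carries the new left factor \<open>a * t\<close>.\<close>

lemma fdiff_L: "fdiff t (\<lambda>u. L (a * u) (h u))
  = (\<lambda>u. L (a * u) (fdiff t h u) + (L (a * t) (h u) + L (a * t) (fdiff t h u)))"
  by (simp add: fdiff_def distrib_left L_add_left diff algebra_simps)

lemma fdiff_R: "fdiff t (\<lambda>u. R (u * e) (h u))
  = (\<lambda>u. R (u * e) (fdiff t h u) + (R (t * e) (h u) + R (t * e) (fdiff t h u)))"
  by (simp add: fdiff_def distrib_right R_add_left diff algebra_simps)

lemma degree_less_L: "degree_less n h \<Longrightarrow> degree_less (Suc n) (\<lambda>u. L (a * u) (h u))"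
proof (induction n arbitrary: h)
  case 0
  then show ?case by (simp add: fdiff_def)
next
  case (Suc n)
  have "degree_less (Suc n) (fdiff t (\<lambda>u. L (a * u) (h u)))" for t
    unfolding fdiff_L using Suc degree_less_Suc[of n "fdiff t h"]
    by (intro degree_less_add degree_less_compose[of "L (a * t)"] Suc.IH)
      (auto simp: L_add_right simp del: degree_less.simps(2) intro: degree_less.simps(2)[THEN iffD1, rule_format])
  then show ?case by (subst degree_less.simps) blast
qed

lemma degree_less_R: "degree_less n h \<Longrightarrow> degree_less (Suc n) (\<lambda>u. R (u * e) (h u))"
proof (induction n arbitrary: h)
  case 0
  then show ?case by (simp add: fdiff_def)
next
  case (Suc n)
  have "degree_less (Suc n) (fdiff t (\<lambda>u. R (u * e) (h u)))" for t
    unfolding fdiff_R using Suc degree_less_Suc[of n "fdiff t h"]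
    by (intro degree_less_add degree_less_compose[of "R (t * e)"] Suc.IH)
      (auto simp: R_add_right simp del: degree_less.simps(2) intro: degree_less.simps(2)[THEN iffD1, rule_format])
  then show ?case by (subst degree_less.simps) blast
qed

text \<open>
  These classes control terms of top degree only: \<open>low\<close> absorbs everything of smaller degree.
  The flag \<open>r\<close> tells whether variables may occur to the right of the module element; it is off
  when the bimodule is \<open>D\<close> itself, where left and right cannot be told apart.
\<close>

inductive right_poly :: "bool \<Rightarrow> nat \<Rightarrow> ('a \<Rightarrow> 'v) \<Rightarrow> bool" for r
where
  low: "degree_less n f \<Longrightarrow> right_poly r n f"
| const: "right_poly r 0 (\<lambda>_. v)"
| add: "right_poly r n f \<Longrightarrow> right_poly r n g \<Longrightarrow> right_poly r n (\<lambda>u. f u + g u)"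
| right: "r \<Longrightarrow> right_poly r n f \<Longrightarrow> right_poly r (Suc n) (\<lambda>u. R (u * e) (f u))"

inductive mixed_poly :: "bool \<Rightarrow> 'a set \<Rightarrow> nat \<Rightarrow> ('a \<Rightarrow> 'v) \<Rightarrow> bool" for r
where
  right_poly: "right_poly r n f \<Longrightarrow> mixed_poly r A n f"
| add: "mixed_poly r A n f \<Longrightarrow> mixed_poly r A n g \<Longrightarrow> mixed_poly r A n (\<lambda>u. f u + g u)"
| left: "a \<in> A \<Longrightarrow> finite B \<Longrightarrow> mixed_poly r B n f \<Longrightarrow> mixed_poly r A (Suc n) (\<lambda>u. L (a * u) (f u))"

lemma right_poly_degree: "right_poly r n f \<Longrightarrow> degree_less (Suc n) f"
  by (induction rule: right_poly.induct)
    (auto intro: degree_less_Suc degree_less_const degree_less_add degree_less_R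
      simp del: degree_less.simps)

lemma mixed_poly_degree: "mixed_poly r A n f \<Longrightarrow> degree_less (Suc n) f"
  by (induction rule: mixed_poly.induct)
    (auto intro: right_poly_degree degree_less_add degree_less_L simp del: degree_less.simps)

lemma right_poly_R: "right_poly r n f \<Longrightarrow> right_poly r n (\<lambda>u. R c (f u))"
proof (induction rule: right_poly.induct)
  case (low n f)
  then show ?case by (intro right_poly.low degree_less_compose[of "R c"]) (auto simp: R_add_right)
next
  case (right n f e)
  then show ?case
    using right_poly.right[of r n f "e * c"] by (simp add: mult.assoc R_mult[symmetric])
qed (auto simp: R_add_right intro: right_poly.intros)

lemma right_poly_L: "right_poly r n f \<Longrightarrow> right_poly r n (\<lambda>u. L c (f u))"
proof (induction rule: right_poly.induct)
  case (low n f)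
  then show ?case by (intro right_poly.low degree_less_compose[of "L c"]) (auto simp: L_add_right)
qed (auto simp: L_add_right L_R intro: right_poly.intros)

lemma mixed_poly_L: "mixed_poly r A n f \<Longrightarrow> mixed_poly r ((*) c ` A) n (\<lambda>u. L c (f u))"
proof (induction rule: mixed_poly.induct)
  case (left a A B n f)
  then show ?case
    using mixed_poly.left[of "c * a" "(*) c ` A" B r n f]
    by (auto simp: L_mult)
qed (auto simp: L_add_right intro: mixed_poly.intros right_poly_L)

lemma mixed_poly_mono: "mixed_poly r A n f \<Longrightarrow> A \<subseteq> B \<Longrightarrow> mixed_poly r B n f"
  by (induction rule: mixed_poly.induct) (auto intro: mixed_poly.intros)

lemma mixed_poly_low: "degree_less n f \<Longrightarrow> mixed_poly r A n f"
  by (intro mixed_poly.right_poly right_poly.low)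

lemma right_poly_fdiff: "right_poly r (Suc n) f \<Longrightarrow> right_poly r n (fdiff t f)"
proof (induction "Suc n" f arbitrary: n rule: right_poly.induct)
  case (low f)
  then show ?case by (auto intro: right_poly.low)
next
  case (add f g)
  then show ?case by (auto simp: fdiff_add intro: right_poly.add)
next
  case (right n f e)
  have low: "degree_less n (fdiff t f)"
    using right_poly_degree[OF right(2)] by simp
  have "right_poly r n (\<lambda>u. R (u * e) (fdiff t f u))"
  proof (cases n)
    case 0
    then show ?thesis using low by (auto intro: right_poly.low)
  next
    case (Suc m)
    then show ?thesis using right by (auto intro: right_poly.right)
  qed
  moreover have "right_poly r n (\<lambda>u. R (t * e) (fdiff t f u))"
    by (rule right_poly_R[OF right_poly.low[OF low]])
  ultimately show ?case
    unfolding fdiff_R by (intro right_poly.add) (auto intro: right_poly_R[OF right(2)])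
qed

text \<open>In \<open>L (a * u) (f u)\<close> the difference falls either on \<open>f\<close>, which
  keeps the outer coefficient \<open>a\<close>, or on the first variable, which then merges
  \<open>a\<close> with an outer coefficient \<open>y\<close> of \<open>f\<close> into
  \<open>a * t * y\<close>. The set \<open>B\<close> does not depend on \<open>t\<close>, so a
  genericity condition can be fixed before \<open>t\<close> is chosen.\<close>

lemma mixed_poly_fdiff:
  assumes "mixed_poly r A (Suc n) f"
  shows "\<exists>B. finite B \<and> (\<forall>t. mixed_poly r (A \<union> {x * t * y | x y. x \<in> A \<and> y \<in> B}) n (fdiff t f))"
  using assms
proof (induction A "Suc n" f arbitrary: n rule: mixed_poly.induct)
  case (right_poly f A)
  then show ?case
    by (intro exI[of _ "{}"]) (auto intro!: mixed_poly.right_poly right_poly_fdiff)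
next
  case (add A f g)
  obtain B B' where "finite B" "finite B'"
    and f: "\<And>t. mixed_poly r (A \<union> {x * t * y | x y. x \<in> A \<and> y \<in> B}) n (fdiff t f)"
    and g: "\<And>t. mixed_poly r (A \<union> {x * t * y | x y. x \<in> A \<and> y \<in> B'}) n (fdiff t g)"
    using add by blast
  then show ?case
    unfolding fdiff_add
    by (intro exI[of _ "B \<union> B'"] conjI allI mixed_poly.add mixed_poly_mono[OF f] mixed_poly_mono[OF g])
      auto
next
  case (left a A B n f)
  have low: "degree_less n (fdiff t f)" for t
    using mixed_poly_degree[OF left(3)] by simp
  have m1: "mixed_poly r A n (\<lambda>u. L (a * u) (fdiff t f u))" for t
  proof (cases n)
    case 0
    then show ?thesis using low[of t] by (auto intro: mixed_poly_low)
  next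
    case (Suc m)
    then obtain C where "finite C"
      "mixed_poly r (B \<union> {x * t * y | x y. x \<in> B \<and> y \<in> C}) m (fdiff t f)"
      using left by blast
    moreover have "finite {x * t * y | x y. x \<in> B \<and> y \<in> C}"
      using \<open>finite C\<close> left(2) by (intro finite_image_set2) auto
    ultimately show ?thesis using left(1,2) Suc by (auto intro: mixed_poly.left)
  qed
  have m2: "mixed_poly r {x * t * y | x y. x \<in> A \<and> y \<in> B} n (\<lambda>u. L (a * t) (f u))" for t
    using left(1) by (intro mixed_poly_mono[OF mixed_poly_L[OF left(3)]]) auto
  have m3: "mixed_poly r A n (\<lambda>u. L (a * t) (fdiff t f u))" for t
    using low by (intro mixed_poly_low degree_less_compose[of "L (a * t)"]) (auto simp: L_add_right)
  show ?case
    unfolding fdiff_L using left(2)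
    by (intro exI[of _ B] conjI allI mixed_poly.add mixed_poly_mono[OF m1] mixed_poly_mono[OF m2]
        mixed_poly_mono[OF m3]) auto
qed

text \<open>These are the functions of the increment \<open>t\<close> obtained as differences of
  \<open>mixed_poly\<close> maps of degree at most one.\<close>

inductive mixed_linear :: "bool \<Rightarrow> 'a set \<Rightarrow> ('a \<Rightarrow> 'v) \<Rightarrow> bool" for r A
where
  zero: "mixed_linear r A (\<lambda>_. 0)"
| add: "mixed_linear r A f \<Longrightarrow> mixed_linear r A g \<Longrightarrow> mixed_linear r A (\<lambda>t. f t + g t)"
| left: "a \<in> A \<Longrightarrow> mixed_linear r A (\<lambda>t. L (a * t) v)"
| right: "r \<Longrightarrow> mixed_linear r A (\<lambda>t. R (t * e) v)"

lemma mixed_linear_add: "mixed_linear r A f \<Longrightarrow> f (s + t) = f s + f t"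
  by (induction rule: mixed_linear.induct)
    (simp_all add: distrib_left distrib_right L_add_left R_add_left algebra_simps)

lemma right_poly_1_fdiff:
  assumes "right_poly r (Suc 0) f"
  shows "\<exists>\<rho>. mixed_linear r A \<rho> \<and> (\<forall>t u. fdiff t f u = \<rho> t)"
  using assms
proof (induction "Suc 0" f rule: right_poly.induct)
  case (low f)
  then show ?case by (auto intro!: exI[of _ "\<lambda>_. 0"] mixed_linear.zero)
next
  case (add f g)
  then obtain \<rho> \<sigma> where "mixed_linear r A \<rho>" "\<And>t u. fdiff t f u = \<rho> t"
    "mixed_linear r A \<sigma>" "\<And>t u. fdiff t g u = \<sigma> t" by blast
  then show ?case
    by (intro exI[of _ "\<lambda>t. \<rho> t + \<sigma> t"]) (simp add: fdiff_add mixed_linear.add)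
next
  case (right f e)
  then have f0: "f u = f 0" for u
    using right_poly_degree[OF right(2)] degree_less_1_const by blast
  have "fdiff t (\<lambda>u. R (u * e) (f u)) u = R (t * e) (f 0)" for t u
    using f0[of "u + t"] f0[of u]
    by (simp add: fdiff_def distrib_right R_add_left)
  then show ?case using right(1) by (blast intro: mixed_linear.right)
qed

lemma mixed_poly_1_fdiff:
  assumes "mixed_poly r A (Suc 0) f"
  shows "\<exists>\<rho>. mixed_linear r A \<rho> \<and> (\<forall>t u. fdiff t f u = \<rho> t)"
  using assms
proof (induction A "Suc 0" f rule: mixed_poly.induct)
  case (right_poly f A)
  then show ?case by (intro right_poly_1_fdiff)
next
  case (add A f g)
  then obtain \<rho> \<sigma> where "mixed_linear r A \<rho>" "\<And>t u. fdiff t f u = \<rho> t"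
    "mixed_linear r A \<sigma>" "\<And>t u. fdiff t g u = \<sigma> t" by blast
  then show ?case
    by (intro exI[of _ "\<lambda>t. \<rho> t + \<sigma> t"]) (simp add: fdiff_add mixed_linear.add)
next
  case (left a A B f)
  then have f0: "f u = f 0" for u
    using mixed_poly_degree[OF left(3)] degree_less_1_const by blast
  have "fdiff t (\<lambda>u. L (a * u) (f u)) u = L (a * t) (f 0)" for t u
    using f0[of "u + t"] f0[of u]
    by (simp add: fdiff_def distrib_left L_add_left)
  then show ?case using left(1) by (blast intro: mixed_linear.left)
qed

text \<open>Each generic difference lowers the degree of \<open>h\<close> by one. The terms it
  creates beside \<open>L (b * u) (fdiff t h u)\<close> go into \<open>f\<close>, and genericity
  keeps their leading coefficients independent of \<open>b\<close>. At the end \<open>h\<close> is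
  constant and \<open>f\<close> is affine, which is the situation of \<open>base\<close>.\<close>

lemma peel_left:
  assumes inf: "\<not> finite_dimensional_over_center TYPE('a)"
    and N: "subbimodule N"
    and base: "\<And>A b v \<rho>. \<lbrakk>finite A; b \<notin> center.span A; mixed_linear r A \<rho>;
      \<And>t. L (b * t) v + \<rho> t \<in> N\<rbrakk> \<Longrightarrow> v \<in> N'"
    and "finite A" "finite B" "b \<notin> center.span A"
    and "mixed_poly r B n h" "mixed_poly r A (Suc n) f"
    and "generic_degree_less N (Suc n) (\<lambda>u. L (b * u) (h u) + f u)"
  shows "generic_degree_less N' n h"
  using assms(4-)
proof (induction n arbitrary: A B h f)
  case 0
  have h: "h u = h 0" for u
    using mixed_poly_degree[OF 0(4)] degree_less_1_const by blast
  obtain \<rho> where \<rho>: "mixed_linear r A \<rho>" "\<And>t u. fdiff t f u = \<rho> t"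
    using mixed_poly_1_fdiff[OF 0(5)] by blast
  have lin: "fdiff t (\<lambda>u. L (b * u) (h u) + f u) u = L (b * t) (h 0) + \<rho> t" for t u
    unfolding fdiff_add \<rho>(2) using h[of "u + t"] h[of u] by (simp add: fdiff_def distrib_left L_add_left)
  obtain F where F: "finite F" "\<And>t. generic F t \<Longrightarrow> L (b * t) (h 0) + \<rho> t \<in> N"
    using 0(6) lin by auto
  \<comment> \<open>Membership is known only for generic arguments, but the expression is additive
    and every \<open>s\<close> is a difference of two of them.\<close>
  have "L (b * s) (h 0) + \<rho> s \<in> N" for s
  proof -
    obtain t where "generic F t" "generic F (t + s)"
      using generic_shift[OF F(1), of s] generic_exists[OF inf] by blast
    then have "(L (b * (t + s)) (h 0) + \<rho> (t + s)) - (L (b * t) (h 0) + \<rho> t) \<in> N"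
      using F(2) subbimoduleD(6)[OF N] by blast
    then show ?thesis
      by (simp add: distrib_left L_add_left mixed_linear_add[OF \<rho>(1)] algebra_simps)
  qed
  then have "h 0 \<in> N'" using base[OF 0(1,3) \<rho>(1)] by blast
  then show ?case using h by (metis generic_degree_less.simps(1))
next
  case (Suc n)
  obtain C where C: "finite C"
      "\<And>t. mixed_poly r (A \<union> {x * t * y | x y. x \<in> A \<and> y \<in> C}) (Suc n) (fdiff t f)"
    using mixed_poly_fdiff[OF Suc.prems(5)] by blast
  obtain C' where C': "finite C'"
      "\<And>t. mixed_poly r (B \<union> {x * t * y | x y. x \<in> B \<and> y \<in> C'}) n (fdiff t h)"
    using mixed_poly_fdiff[OF Suc.prems(4)] by blast
  obtain F where F: "finite F"
      "\<And>t. generic F t \<Longrightarrow>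
        generic_degree_less N (Suc n) (fdiff t (\<lambda>u. L (b * u) (h u) + f u))"
    using Suc.prems(6) unfolding generic_degree_less.simps(2)[of N "Suc n"] by blast
  \<comment> \<open>\<open>G\<close> collects all coefficients that can enter \<open>A'\<close>
    below, together with \<open>b\<close> and the condition \<open>F\<close> from the
    hypothesis.\<close>
  define G where "G = F \<union> insert b A \<union> B \<union> C"
  have "finite G" using F(1) C(1) Suc.prems(1,2) by (simp add: G_def)
  have "generic_degree_less N' n (fdiff t h)" if t: "generic G t" for t
  proof -
    define A' where "A' = A \<union> {x * t * y | x y. x \<in> insert b A \<and> y \<in> B \<union> C}"
    define f' where "f' = (\<lambda>u. fdiff t f u + (L (b * t) (h u) + L (b * t) (fdiff t h u)))"
    have eq: "fdiff t (\<lambda>u. L (b * u) (h u) + f u) = (\<lambda>u. L (b * u) (fdiff t h u) + f' u)"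
      unfolding fdiff_add fdiff_L f'_def by (simp add: algebra_simps)
    have low: "degree_less (Suc n) (fdiff t h)"
      using mixed_poly_degree[OF Suc.prems(4)] by simp
    have "mixed_poly r A' (Suc n) (fdiff t f)"
      using C(2)[of t] by (rule mixed_poly_mono) (auto simp: A'_def)
    moreover have "mixed_poly r A' (Suc n) (\<lambda>u. L (b * t) (h u))"
      using mixed_poly_L[OF Suc.prems(4)] by (rule mixed_poly_mono) (auto simp: A'_def)
    moreover have "mixed_poly r A' (Suc n) (\<lambda>u. L (b * t) (fdiff t h u))"
      using low by (intro mixed_poly_low degree_less_compose[of "L (b * t)"]) (auto simp: L_add_right)
    ultimately have "mixed_poly r A' (Suc n) f'"
      unfolding f'_def by (intro mixed_poly.add)
    moreover have "finite A'"
      unfolding A'_def using Suc.prems(1,2) C(1) by (intro finite_UnI finite_image_set2) auto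
    moreover have "finite (B \<union> {x * t * y | x y. x \<in> B \<and> y \<in> C'})"
      using Suc.prems(2) C'(1) by (intro finite_UnI finite_image_set2) auto
    moreover have "b \<notin> center.span A'"
      unfolding A'_def using t \<open>finite G\<close> Suc.prems(3)
      by (intro generic_span[of G]) (auto simp: G_def)
    moreover have "generic_degree_less N (Suc n) (\<lambda>u. L (b * u) (fdiff t h u) + f' u)"
      using F(2)[of t] generic_mono[OF t _ \<open>finite G\<close>, of F] unfolding eq by (auto simp: G_def simp del: generic_degree_less.simps)
    ultimately show ?thesis using Suc.IH C'(2) by blast
  qed
  then show ?case using \<open>finite G\<close> by auto
qed

end


section \<open>Separating coefficients\<close>

context bimodule begin

lemma right_form_single:
  "\<exists>S x. finite S \<and> S \<subseteq> center_basis \<and> (\<forall>t. R (t * e) w = (\<Sum>b\<in>S. R (t * b) (x b)))"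
proof -
  obtain S z where S: "finite S" "S \<subseteq> center_basis" "e = (\<Sum>b\<in>S. center_scale (z b) b)"
    by (rule center_basis_expansion)
  have "R (t * e) w = (\<Sum>b\<in>S. R (t * b) (R (of_center (z b)) w))" for t
    unfolding S(3) sum_distrib_left sum_left center_scale_mult
    by (simp add: center_scale_def R_mult[symmetric])
  then show ?thesis
    using S(1,2) by (intro exI[of _ S] exI[of _ "\<lambda>b. R (of_center (z b)) w"]) simp
qed

lemma right_form_add:
  assumes "finite S" "finite S'"
  shows "(\<Sum>b\<in>S. R (t * b) (x b)) + (\<Sum>b\<in>S'. R (t * b) (x' b))
    = (\<Sum>b\<in>S \<union> S'. R (t * b) ((if b \<in> S then x b else 0) + (if b \<in> S' then x' b else 0)))"
proof -
  have "(\<Sum>b\<in>S. R (t * b) (x b)) = (\<Sum>b\<in>S \<union> S'. R (t * b) (if b \<in> S then x b else 0))"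
    "(\<Sum>b\<in>S'. R (t * b) (x' b)) = (\<Sum>b\<in>S \<union> S'. R (t * b) (if b \<in> S' then x' b else 0))"
    using assms by (auto intro!: sum.mono_neutral_cong_left)
  then show ?thesis by (simp add: R_add_right sum.distrib)
qed

text \<open>Replacing \<open>t\<close> by \<open>q i * t\<close> and acting by \<open>p i\<close>
  from the left turns a coefficient \<open>a\<close> into the sum of the
  \<open>p i * a * q i\<close>, so the terms with coefficients in \<open>A\<close> disappear. Terms
  with the variable on the right keep their form, with a new module element.\<close>

lemma mixed_linear_transform:
  assumes "mixed_linear r A \<rho>" and p: "\<And>a. a \<in> A \<Longrightarrow> (\<Sum>i<n. p i * a * q i) = 0"
  shows "\<exists>S x. finite S \<and> S \<subseteq> center_basis \<and> (\<not> r \<longrightarrow> S = {})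
    \<and> (\<forall>t. (\<Sum>i<(n::nat). L (p i) (\<rho> (q i * t))) = (\<Sum>b\<in>S. R (t * b) (x b)))"
  using assms(1)
proof (induction rule: mixed_linear.induct)
  case zero
  show ?case by (intro exI[of _ "{}"]) simp
next
  case (add f g)
  obtain S x where S: "finite S" "S \<subseteq> center_basis" "\<not> r \<longrightarrow> S = {}"
    "\<And>t. (\<Sum>i<n. L (p i) (f (q i * t))) = (\<Sum>b\<in>S. R (t * b) (x b))" using add by blast
  obtain S' x' where S': "finite S'" "S' \<subseteq> center_basis" "\<not> r \<longrightarrow> S' = {}"
    "\<And>t. (\<Sum>i<n. L (p i) (g (q i * t))) = (\<Sum>b\<in>S'. R (t * b) (x' b))" using add by blast
  have "(\<Sum>i<n. L (p i) (f (q i * t) + g (q i * t)))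
    = (\<Sum>b\<in>S \<union> S'. R (t * b) ((if b \<in> S then x b else 0) + (if b \<in> S' then x' b else 0)))" for t
    using right_form_add[OF S(1) S'(1)] S(4) S'(4) by (simp add: L_add_right sum.distrib)
  then show ?case using S S'
    by (intro exI[of _ "S \<union> S'"]
        exI[of _ "\<lambda>b. (if b \<in> S then x b else 0) + (if b \<in> S' then x' b else 0)"]) simp
next
  case (left a v)
  have "(\<Sum>i<n. L (p i) (L (a * (q i * t)) v)) = L ((\<Sum>i<n. p i * a * q i) * t) v" for t
    by (simp add: L_mult[symmetric] sum_left sum_distrib_right mult.assoc)
  then show ?case using p[OF left] by (intro exI[of _ "{}"]) simp
next
  case (right e v)
  have "(\<Sum>i<n. L (p i) (R (q i * t * e) v)) = R (t * e) (\<Sum>i<n. L (p i) (R (q i) v))" for t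
    by (simp add: sum L_R mult.assoc R_mult)
  then show ?case using right_form_single right by simp
qed

text \<open>An operator with value 1 at \<open>b\<close> and 0 on the rest of \<open>S\<close>
  isolates \<open>x b\<close>: its left factors are substituted for \<open>t\<close>, and its right
  factors act from the right.\<close>

lemma right_form_coeffs:
  assumes N: "subbimodule N" and S: "finite S" "S \<subseteq> center_basis"
    and X: "\<And>t. (\<Sum>b\<in>S. R (t * b) (x b)) \<in> N" and "b \<in> S"
  shows "x b \<in> N"
proof -
  obtain T where T: "elementary_operator T" "T b = 1" "\<And>a. a \<in> S - {b} \<Longrightarrow> T a = 0"
    using artin_whaples[OF _ center_basis_notin_span[OF \<open>b \<in> S\<close> S(2)]] S(1) by blast
  obtain n :: nat and p q where T': "\<And>y. T y = (\<Sum>i<n. p i * y * q i)"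
    using T(1) by (rule elementary_operatorE) blast
  have "(\<Sum>i<n. R (q i) (\<Sum>a\<in>S. R (p i * a) (x a))) = (\<Sum>a\<in>S. R (T a) (x a))"
    unfolding sum T' sum_left by (subst sum.swap) (simp add: R_mult)
  also have "\<dots> = (\<Sum>a\<in>S. if a = b then x a else 0)"
    using T(2,3) by (intro sum.cong) (auto simp: R_one)
  finally have "x b = (\<Sum>i<n. R (q i) (\<Sum>a\<in>S. R (p i * a) (x a)))"
    using S(1) \<open>b \<in> S\<close> by simp
  then show ?thesis using X N by (simp add: subbimodule_sum subbimoduleD)
qed

section \<open>Elements that commute with \<open>D\<close> modulo a subbimodule\<close>

definition central_mod :: "'v set \<Rightarrow> 'v \<Rightarrow> bool"
  where "central_mod N c \<longleftrightarrow> (\<forall>x. L x c - R x c \<in> N)"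

definition central_closure :: "'v set \<Rightarrow> 'v set"
  where "central_closure N = {v. \<exists>C d. finite C \<and> (\<forall>c\<in>C. central_mod N c)
    \<and> v - (\<Sum>c\<in>C. L (d c) c) \<in> N}"

lemma central_closureI:
  assumes "finite C" "\<And>c. c \<in> C \<Longrightarrow> central_mod N c" "v - (\<Sum>c\<in>C. L (d c) c) \<in> N"
  shows "v \<in> central_closure N"
  using assms unfolding central_closure_def by blast

lemma central_closure_superset: "N \<subseteq> central_closure N"
  unfolding central_closure_def by (auto intro!: exI[of _ "{}"])

lemma central_mod_closure:
  assumes "subbimodule N" "central_mod N c"
  shows "c \<in> central_closure N"
  unfolding central_closure_def
  using assms by (auto intro!: exI[of _ "{c}"] exI[of _ "\<lambda>_. 1"] simp: L_one subbimoduleD)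

lemma subbimodule_central_closure:
  assumes N: "subbimodule N"
  shows "subbimodule (central_closure N)"
  unfolding subbimodule_def
proof (intro conjI ballI allI)
  show "0 \<in> central_closure N"
    using central_closure_superset subbimoduleD(1)[OF N] by blast
next
  fix v w
  assume "v \<in> central_closure N" "w \<in> central_closure N"
  then obtain C d C' d' where C: "finite C" "\<forall>c\<in>C. central_mod N c" "v - (\<Sum>c\<in>C. L (d c) c) \<in> N"
    and C': "finite C'" "\<forall>c\<in>C'. central_mod N c" "w - (\<Sum>c\<in>C'. L (d' c) c) \<in> N"
    unfolding central_closure_def by blast
  define e where "e c = (if c \<in> C then d c else 0) + (if c \<in> C' then d' c else 0)" for c
  have "(\<Sum>c\<in>C. L (d c) c) = (\<Sum>c\<in>C \<union> C'. L (if c \<in> C then d c else 0) c)"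
    "(\<Sum>c\<in>C'. L (d' c) c) = (\<Sum>c\<in>C \<union> C'. L (if c \<in> C' then d' c else 0) c)"
    using C(1) C'(1) by (auto intro!: sum.mono_neutral_cong_left)
  then have "(\<Sum>c\<in>C \<union> C'. L (e c) c) = (\<Sum>c\<in>C. L (d c) c) + (\<Sum>c\<in>C'. L (d' c) c)"
    by (simp add: e_def L_add_left sum.distrib)
  then have eq: "v + w - (\<Sum>c\<in>C \<union> C'. L (e c) c)
      = (v - (\<Sum>c\<in>C. L (d c) c)) + (w - (\<Sum>c\<in>C'. L (d' c) c))"
    by simp
  have "v + w - (\<Sum>c\<in>C \<union> C'. L (e c) c) \<in> N"
    unfolding eq by (rule subbimoduleD(2)[OF N C(3) C'(3)])
  then show "v + w \<in> central_closure N"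
    using C(1,2) C'(1,2) by (intro central_closureI[of "C \<union> C'"]) auto
next
  fix a v
  assume "v \<in> central_closure N"
  then obtain C d where C: "finite C" "\<forall>c\<in>C. central_mod N c" "v - (\<Sum>c\<in>C. L (d c) c) \<in> N"
    unfolding central_closure_def by blast
  have "L a v - (\<Sum>c\<in>C. L (a * d c) c) = L a (v - (\<Sum>c\<in>C. L (d c) c))"
    by (simp add: diff sum L_mult)
  then have "L a v - (\<Sum>c\<in>C. L (a * d c) c) \<in> N"
    using C(3) subbimoduleD(3)[OF N] by simp
  then show "L a v \<in> central_closure N"
    using C(1,2) by (intro central_closureI[of C]) auto
  \<comment> \<open>Since \<open>c\<close> commutes with \<open>D\<close> modulo \<open>N\<close>,
    the right action of \<open>a\<close> can be moved into the left coefficient of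
    \<open>c\<close>.\<close>
  have "R a v - (\<Sum>c\<in>C. L (d c * a) c)
      = R a (v - (\<Sum>c\<in>C. L (d c) c)) - (\<Sum>c\<in>C. L (d c) (L a c - R a c))"
    by (simp add: diff sum L_mult L_R sum_subtractf)
  moreover have "(\<Sum>c\<in>C. L (d c) (L a c - R a c)) \<in> N"
    using C(2) N by (intro subbimodule_sum subbimoduleD(3)) (auto simp: central_mod_def)
  ultimately have "R a v - (\<Sum>c\<in>C. L (d c * a) c) \<in> N"
    using C(3) N by (simp add: subbimoduleD)
  then show "R a v \<in> central_closure N"
    using C(1,2) by (intro central_closureI[of C]) auto
qed

text \<open>
  The linear case of the peeling argument: the coefficient \<open>v\<close> after \<open>b\<close> can be isolated, up to \<open>N'\<close>.
\<close>

definition separates :: "bool \<Rightarrow> 'v set \<Rightarrow> 'v set \<Rightarrow> bool"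
  where "separates r N N' \<longleftrightarrow> (\<forall>A b v \<rho>. finite A \<longrightarrow> b \<notin> center.span A \<longrightarrow> mixed_linear r A \<rho> \<longrightarrow>
    (\<forall>t. L (b * t) v + \<rho> t \<in> N) \<longrightarrow> v \<in> N')"

text \<open>An elementary operator with value 1 at \<open>b\<close> that kills \<open>A\<close>
  normalizes the relation: \<open>b\<close> becomes 1 and only terms with the variable on the right
  survive in \<open>\<rho>\<close>.\<close>

lemma separate_form:
  assumes N: "subbimodule N" and "finite A" "b \<notin> center.span A" "mixed_linear r A \<rho>"
    and \<rho>: "\<And>t. L (b * t) v + \<rho> t \<in> N"
  obtains S x where "finite S" "S \<subseteq> center_basis" "\<not> r \<longrightarrow> S = {}"
    "\<And>t. L t v + (\<Sum>e\<in>S. R (t * e) (x e)) \<in> N"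
proof -
  obtain T where T: "elementary_operator T" "T b = 1" "\<And>a. a \<in> A \<Longrightarrow> T a = 0"
    using artin_whaples[OF assms(2,3)] by blast
  obtain n :: nat and p q where T': "\<And>y. T y = (\<Sum>i<n. p i * y * q i)"
    using T(1) by (rule elementary_operatorE) blast
  obtain S x where S: "finite S" "S \<subseteq> center_basis" "\<not> r \<longrightarrow> S = {}"
    "\<And>t. (\<Sum>i<n. L (p i) (\<rho> (q i * t))) = (\<Sum>b\<in>S. R (t * b) (x b))"
    using mixed_linear_transform[OF assms(4), where n = n and p = p and q = q] T(3) unfolding T' by blast
  have "L t v + (\<Sum>e\<in>S. R (t * e) (x e)) \<in> N" for t
  proof -
    have "(\<Sum>i<n. L (p i) (L (b * (q i * t)) v)) = L (T b * t) v"
      by (simp add: T' L_mult[symmetric] sum_left sum_distrib_right mult.assoc)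
    then have "L t v + (\<Sum>e\<in>S. R (t * e) (x e))
        = (\<Sum>i<n. L (p i) (L (b * (q i * t)) v + \<rho> (q i * t)))"
      using T(2) by (simp add: L_add_right sum.distrib S(4))
    then show ?thesis using \<rho> N by (simp add: subbimodule_sum subbimoduleD)
  qed
  with S(1-3) show ?thesis by (rule that)
qed

lemma separates_False: "subbimodule N \<Longrightarrow> separates False N N"
  unfolding separates_def
proof (intro allI impI)
  fix A b v \<rho>
  assume N: "subbimodule N"
    and *: "finite A" "b \<notin> center.span A" "mixed_linear False A \<rho>" "\<forall>t. L (b * t) v + \<rho> t \<in> N"
  obtain S x where "S = {}" "\<And>t. L t v + (\<Sum>e\<in>S. R (t * e) (x e)) \<in> N"
    using separate_form[OF N *(1-3)] *(4) by metis
  then have "L 1 v \<in> N" by (metis add.right_neutral sum.empty)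
  then show "v \<in> N" by (simp add: L_one)
qed

text \<open>Comparing the relation at \<open>a * t\<close> with \<open>L a\<close> of the relation
  at \<open>t\<close> eliminates \<open>v\<close>. Linear independence of the right coefficients
  then shows that every \<open>x e\<close> commutes with \<open>a\<close> modulo \<open>N\<close>,
  and the relation at \<open>t = 1\<close> expresses \<open>v\<close> through the
  \<open>x e\<close>.\<close>

lemma separates_True:
  assumes N: "subbimodule N"
  shows "separates True N (central_closure N)"
  unfolding separates_def
proof (intro allI impI)
  fix A b v \<rho>
  assume *: "finite A" "b \<notin> center.span A" "mixed_linear True A \<rho>" "\<forall>t. L (b * t) v + \<rho> t \<in> N"
  obtain S x where S: "finite S" "S \<subseteq> center_basis"
      and X: "\<And>t. L t v + (\<Sum>e\<in>S. R (t * e) (x e)) \<in> N"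
    using separate_form[OF N *(1-3)] *(4) by metis
  have "R a (x e) - L a (x e) \<in> N" if "e \<in> S" for a e
  proof (rule right_form_coeffs[OF N S _ that])
    fix t
    have "(L (a * t) v + (\<Sum>e\<in>S. R (a * t * e) (x e))) - L a (L t v + (\<Sum>e\<in>S. R (t * e) (x e)))
      = (\<Sum>e\<in>S. R (t * e) (R a (x e) - L a (x e)))"
      by (simp add: L_add_right L_mult sum diff sum_subtractf R_mult L_R mult.assoc)
    moreover have "(L (a * t) v + (\<Sum>e\<in>S. R (a * t * e) (x e)))
        - L a (L t v + (\<Sum>e\<in>S. R (t * e) (x e))) \<in> N"
      by (intro subbimoduleD(6)[OF N] subbimoduleD(3)[OF N] X)
    ultimately show "(\<Sum>e\<in>S. R (t * e) (R a (x e) - L a (x e))) \<in> N" by simp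
  qed
  then have "central_mod N (x e)" if "e \<in> S" for e
    unfolding central_mod_def using subbimoduleD(5)[OF N] that by (metis minus_diff_eq)
  then have x: "x e \<in> central_closure N" if "e \<in> S" for e
    using central_mod_closure[OF N] that by blast
  note N' = subbimodule_central_closure[OF N]
  have "(L 1 v + (\<Sum>e\<in>S. R (1 * e) (x e))) - (\<Sum>e\<in>S. R (1 * e) (x e)) \<in> central_closure N"
    using X[of 1] central_closure_superset x
    by (intro subbimoduleD(6)[OF N'] subbimodule_sum[OF N'] subbimoduleD(4)[OF N']) blast+
  then show "v \<in> central_closure N" by (simp add: L_one)
qed

end

text \<open>The bound \<open>n\<close> is strict: a constant needs \<open>Suc n\<close>, and 0 is
  all that has degree less than 0. Monomials are built from their left end because that is where
  variables are peeled off.\<close>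

inductive gp_degree_less :: "nat \<Rightarrow> 'a::division_ring gen_poly \<Rightarrow> bool"
where
  zero: "gp_degree_less n 0"
| const: "gp_degree_less (Suc n) (gp_const c)"
| add: "gp_degree_less n P \<Longrightarrow> gp_degree_less n Q \<Longrightarrow> gp_degree_less n (P + Q)"
| var: "gp_degree_less n P \<Longrightarrow> gp_degree_less (Suc n) (gp_const a * gp_var * P)"

lemma gp_const_hom [simp]:
  "gp_const 0 = 0" "gp_const 1 = 1" "gp_const (a + b) = gp_const a + gp_const b"
  "gp_const (a * b) = gp_const a * gp_const b" "gp_const (- a) = - gp_const a"
  using unital_ring_hom_gp_const unital_ring_hom_zero[OF unital_ring_hom_gp_const]
    unital_ring_hom_uminus[OF unital_ring_hom_gp_const]
  unfolding unital_ring_hom_def by auto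

lemma gp_const_sum: "gp_const (sum f I) = (\<Sum>i\<in>I. gp_const (f i))"
  using sum_comp_morphism[of gp_const f I] by (simp add: comp_def)

lemma gp_eval_sum: "gp_eval (sum f I) y = (\<Sum>i\<in>I. gp_eval (f i) y)"
  using sum_comp_morphism[of "\<lambda>p. gp_eval p y" f I] by (simp add: comp_def)

lemma gp_degree_less_Suc: "gp_degree_less n P \<Longrightarrow> gp_degree_less (Suc n) P"
  by (induction rule: gp_degree_less.induct) (auto intro: gp_degree_less.intros)

lemma gp_degree_less_mono: "m \<le> n \<Longrightarrow> gp_degree_less m P \<Longrightarrow> gp_degree_less n P"
  by (induction rule: dec_induct) (auto intro: gp_degree_less_Suc)

lemma gp_degree_less_0: "gp_degree_less 0 P \<Longrightarrow> P = 0"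
  by (induction "0::nat" P rule: gp_degree_less.induct) auto

lemma gp_degree_less_const_mult: "gp_degree_less n P \<Longrightarrow> gp_degree_less n (gp_const c * P)"
proof (induction rule: gp_degree_less.induct)
  case (const n d)
  then show ?case using gp_degree_less.const[of n "c * d"] by simp
next
  case (var n P a)
  then show ?case using gp_degree_less.var[of n P "c * a"] by (simp add: mult.assoc)
qed (auto simp: distrib_left intro: gp_degree_less.intros)

lemma gp_degree_less_mult:
  "gp_degree_less m P \<Longrightarrow> gp_degree_less n Q \<Longrightarrow> gp_degree_less (m + n) (P * Q)"
proof (induction rule: gp_degree_less.induct)
  case (const m c)
  then show ?case
    by (intro gp_degree_less_mono[of n "Suc m + n"] gp_degree_less_const_mult) auto
next
  case (var m P a)
  then show ?case using gp_degree_less.var[of "m + n" "P * Q" a] by (simp add: mult.assoc)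
qed (auto simp: distrib_right intro: gp_degree_less.intros)

lemma gp_degree_less_exists: "\<exists>n. gp_degree_less n P"
proof (induction P)
  case (const a)
  show ?case using gp_degree_less.const by blast
next
  case var
  have "gp_degree_less 2 (gp_const 1 * gp_var * gp_const 1)"
    unfolding numeral_2_eq_2 by (intro gp_degree_less.intros)
  then show ?case by auto
next
  case (add P Q)
  then obtain m n where "gp_degree_less m P" "gp_degree_less n Q" by blast
  then have "gp_degree_less (max m n) (P + Q)"
    by (intro gp_degree_less.add) (auto elim: gp_degree_less_mono[rotated])
  then show ?case by blast
next
  case (mult P Q)
  then show ?case using gp_degree_less_mult by blast
next
  case (uminus P)
  then obtain n where "gp_degree_less n P" by blast
  then have "gp_degree_less n (gp_const (- 1) * P)" by (rule gp_degree_less_const_mult)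
  then show ?case by auto
qed

lemma gp_degree_less_sum:
  "(\<And>i. i \<in> I \<Longrightarrow> gp_degree_less n (f i)) \<Longrightarrow> gp_degree_less n (sum f I)"
  by (induction I rule: infinite_finite_induct) (auto intro: gp_degree_less.intros)

text \<open>Monomials are grouped by their first coefficient, expanded in
  \<open>center_basis\<close>; central scalars commute with \<open>gp_var\<close> and move into the
  tails \<open>Q b\<close>.\<close>

lemma gp_expansion:
  assumes "gp_degree_less (Suc n) P"
  shows "\<exists>S Q c. finite S \<and> S \<subseteq> center_basis \<and> (\<forall>b. gp_degree_less n (Q b))
    \<and> P = (\<Sum>b\<in>S. gp_const b * gp_var * Q b) + gp_const c"
  using assms
proof (induction "Suc n" P rule: gp_degree_less.induct)
  case zero
  show ?case
    by (intro exI[of _ "{}"] exI[of _ "\<lambda>_. 0"] exI[of _ 0]) (auto intro: gp_degree_less.zero)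
next
  case (const c)
  show ?case
    by (intro exI[of _ "{}"] exI[of _ "\<lambda>_. 0"] exI[of _ c]) (auto intro: gp_degree_less.zero)
next
  case (add P P')
  obtain S Q c where S: "finite S" "S \<subseteq> center_basis" "\<And>b. gp_degree_less n (Q b)"
    "P = (\<Sum>b\<in>S. gp_const b * gp_var * Q b) + gp_const c" using add by blast
  obtain S' Q' c' where S': "finite S'" "S' \<subseteq> center_basis" "\<And>b. gp_degree_less n (Q' b)"
    "P' = (\<Sum>b\<in>S'. gp_const b * gp_var * Q' b) + gp_const c'" using add by blast
  define E where "E b = (if b \<in> S then Q b else 0) + (if b \<in> S' then Q' b else 0)" for b
  have "(\<Sum>b\<in>S. gp_const b * gp_var * Q b)
      = (\<Sum>b\<in>S \<union> S'. gp_const b * gp_var * (if b \<in> S then Q b else 0))"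
    "(\<Sum>b\<in>S'. gp_const b * gp_var * Q' b)
      = (\<Sum>b\<in>S \<union> S'. gp_const b * gp_var * (if b \<in> S' then Q' b else 0))"
    using S(1) S'(1) by (auto intro!: sum.mono_neutral_cong_left)
  then have "P + P' = (\<Sum>b\<in>S \<union> S'. gp_const b * gp_var * E b) + gp_const (c + c')"
    by (simp add: S(4) S'(4) E_def distrib_left sum.distrib algebra_simps)
  moreover have "gp_degree_less n (E b)" for b
    unfolding E_def using S(3) S'(3) by (auto intro: gp_degree_less.intros)
  ultimately show ?case using S(1,2) S'(1,2)
    by (intro exI[of _ "S \<union> S'"] exI[of _ E] exI[of _ "c + c'"]) auto
next
  case (var P a)
  obtain S z where S: "finite S" "S \<subseteq> center_basis" "a = (\<Sum>b\<in>S. center_scale (z b) b)"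
    by (rule center_basis_expansion)
  have eq: "gp_const (center_scale z b) * gp_var * P = gp_const b * gp_var * (gp_const (of_center z) * P)"
    for z b
    unfolding center_scale_def of_center_commute[of z b]
    by (simp only: gp_const_hom mult.assoc gp_const_center_commute)
  have "gp_const a * gp_var * P
      = (\<Sum>b\<in>S. gp_const b * gp_var * (gp_const (of_center (z b)) * P)) + gp_const 0"
    unfolding S(3) gp_const_sum sum_distrib_right by (simp only: eq gp_const_hom add_0_right)
  then show ?case
    using S(1,2) gp_degree_less_const_mult[OF var(1)]
    by (intro exI[of _ S] exI[of _ "\<lambda>b. gp_const (of_center (z b)) * P"] exI[of _ 0] conjI) auto
qed

text \<open>
  Degree is measured by how \<open>P\<close> can be written down, so that no normal form in the free product
  is needed.
\<close>

definition gp_degree :: "nat \<Rightarrow> 'a::division_ring gen_poly \<Rightarrow> bool"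
  where "gp_degree n P \<longleftrightarrow> gp_degree_less (Suc n) P \<and> \<not> gp_degree_less n P"

lemma gp_degree_exists:
  assumes "P \<noteq> 0"
  shows "\<exists>n. gp_degree n P"
proof -
  define m where "m = (LEAST m. gp_degree_less m P)"
  have m: "gp_degree_less m P"
    unfolding m_def using gp_degree_less_exists by (rule LeastI_ex)
  have "m \<noteq> 0" using m gp_degree_less_0 assms by metis
  then obtain n where "m = Suc n" by (cases m) auto
  then have "\<not> gp_degree_less n P"
    using not_less_Least[of n "\<lambda>m. gp_degree_less m P"] by (simp add: m_def)
  then show ?thesis using m \<open>m = Suc n\<close> by (auto simp: gp_degree_def)
qed

lemma gp_degree_0:
  assumes "gp_degree 0 P"
  obtains c where "c \<noteq> 0" "P = gp_const c"
proof -
  obtain S Q c where P: "\<And>b. gp_degree_less 0 (Q b)"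
      "P = (\<Sum>b\<in>S. gp_const b * gp_var * Q b) + gp_const c"
    using gp_expansion[of 0 P] assms unfolding gp_degree_def by blast
  have "P = gp_const c" unfolding P(2) using gp_degree_less_0[OF P(1)] by simp
  moreover have "c \<noteq> 0"
    using assms \<open>P = gp_const c\<close> unfolding gp_degree_def by (auto intro: gp_degree_less.zero)
  ultimately show ?thesis using that by blast
qed

text \<open>If every tail could be written with degree less than \<open>n\<close>, then
  \<open>P\<close> could be written with degree less than \<open>Suc n\<close>; so some tail has
  degree exactly \<open>n\<close>.\<close>

lemma gp_degree_Suc:
  assumes "gp_degree (Suc n) P"
  obtains S Q c b where "finite S" "S \<subseteq> center_basis" "\<And>b. gp_degree_less (Suc n) (Q b)"
    "P = (\<Sum>b\<in>S. gp_const b * gp_var * Q b) + gp_const c" "b \<in> S" "gp_degree n (Q b)"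
proof -
  obtain S Q c where P: "finite S" "S \<subseteq> center_basis" "\<And>b. gp_degree_less (Suc n) (Q b)"
      "P = (\<Sum>b\<in>S. gp_const b * gp_var * Q b) + gp_const c"
    using gp_expansion[of "Suc n" P] assms unfolding gp_degree_def by blast
  have "\<exists>b\<in>S. \<not> gp_degree_less n (Q b)"
  proof (rule ccontr)
    assume "\<not> ?thesis"
    then have "gp_degree_less (Suc n) P"
      unfolding P(4) by (auto intro!: gp_degree_less.intros gp_degree_less_sum)
    then show False using assms by (simp add: gp_degree_def)
  qed
  then show ?thesis using that P by (auto simp: gp_degree_def)
qed

section \<open>Multiplication by generalized polynomials\<close>

context bimodule begin

lemma mixed_poly_gp_mult:
  assumes "gp_degree_less (Suc n) P" "finite B" "mixed_poly r B m f"
  shows "\<exists>A. finite A \<and> mixed_poly r A (n + m) (\<lambda>u. L (gp_eval P u) (f u))"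
  using assms(1)
proof (induction "Suc n" P arbitrary: n rule: gp_degree_less.induct)
  case (zero n)
  show ?case by (intro exI[of _ "{}"]) (auto intro: mixed_poly_low degree_less_zero)
next
  case (const n c)
  show ?case
  proof (cases n)
    case 0
    then show ?thesis using mixed_poly_L[OF assms(3)] assms(2) by auto
  next
    case (Suc k)
    then have "degree_less (n + m) f"
      using mixed_poly_degree[OF assms(3)] by (auto intro: degree_less_mono[rotated] simp del: degree_less.simps)
    then have "mixed_poly r {} (n + m) (\<lambda>u. L c (f u))"
      by (intro mixed_poly_low degree_less_compose[of "L c"]) (auto simp: L_add_right)
    then show ?thesis by auto
  qed
next
  case (add P Q)
  then obtain A A' where "finite A" "finite A'"
    and A: "mixed_poly r A (n + m) (\<lambda>u. L (gp_eval P u) (f u))"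
    and A': "mixed_poly r A' (n + m) (\<lambda>u. L (gp_eval Q u) (f u))" by blast
  then show ?case
    by (intro exI[of _ "A \<union> A'"])
      (auto simp: L_add_left intro!: mixed_poly.add mixed_poly_mono[OF A] mixed_poly_mono[OF A'])
next
  case (var n P a)
  show ?case
  proof (cases n)
    case 0
    then have "P = 0" using var gp_degree_less_0 by blast
    then show ?thesis by (intro exI[of _ "{}"]) (auto intro: mixed_poly_low degree_less_zero)
  next
    case (Suc k)
    then obtain A where "finite A" "mixed_poly r A (k + m) (\<lambda>u. L (gp_eval P u) (f u))"
      using var by blast
    then have "mixed_poly r {a} (Suc (k + m)) (\<lambda>u. L (a * u) (L (gp_eval P u) (f u)))"
      by (intro mixed_poly.left) auto
    then show ?thesis using Suc by (intro exI[of _ "{a}"]) (simp add: L_mult)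
  qed
qed

lemma right_poly_gp_mult:
  assumes "gp_degree_less (Suc m) Q" "right_poly True n f"
  shows "right_poly True (n + m) (\<lambda>u. R (gp_eval Q u) (f u))"
  using assms
proof (induction "Suc m" Q arbitrary: m n f rule: gp_degree_less.induct)
  case (zero m)
  show ?case by (auto intro: right_poly.low degree_less_zero)
next
  case (const m c)
  show ?case
  proof (cases m)
    case 0
    then show ?thesis using right_poly_R[OF const] by simp
  next
    case (Suc k)
    then have "degree_less (n + m) f"
      using right_poly_degree[OF const] by (auto intro: degree_less_mono[rotated] simp del: degree_less.simps)
    then have "right_poly True (n + m) (\<lambda>u. R c (f u))"
      by (intro right_poly.low degree_less_compose[of "R c"]) (auto simp: R_add_right)
    then show ?thesis by simp
  qed
next
  case (add P Q)
  then show ?case by (simp add: R_add_left right_poly.add)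
next
  case (var m P a)
  show ?case
  proof (cases m)
    case 0
    then have "P = 0" using var gp_degree_less_0 by blast
    then show ?thesis by (auto intro: right_poly.low degree_less_zero)
  next
    case (Suc k)
    have "right_poly True (Suc n) (\<lambda>u. R (u * 1) (R a (f u)))"
      using right_poly_R[OF var(3)] by (intro right_poly.right) auto
    then have "right_poly True (Suc n + k) (\<lambda>u. R (gp_eval P u) (R (u * 1) (R a (f u))))"
      using var Suc by blast
    then show ?thesis using Suc by (simp add: R_mult)
  qed
qed

text \<open>The new polynomial is a tail \<open>Q b\<close> of full degree in the expansion of
  \<open>P\<close>. The other basis elements occurring in \<open>P\<close> are independent of
  \<open>b\<close>, so \<open>peel_left\<close> applies with the remaining summands collected in
  \<open>k\<close>.\<close>

lemma peel_gp:
  assumes inf: "\<not> finite_dimensional_over_center TYPE('a)"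
    and N: "subbimodule N" and sep: "separates r N N'"
    and P: "gp_degree (Suc n) P" and f: "finite B" "mixed_poly r B m f"
    and gv: "generic_degree_less N (Suc n + m) (\<lambda>u. L (gp_eval P u) (f u))"
  shows "\<exists>P'. gp_degree n P' \<and> generic_degree_less N' (n + m) (\<lambda>u. L (gp_eval P' u) (f u))"
proof -
  obtain S Q c b where S: "finite S" "S \<subseteq> center_basis" and Q: "\<And>b. gp_degree_less (Suc n) (Q b)"
    and P': "P = (\<Sum>b\<in>S. gp_const b * gp_var * Q b) + gp_const c" and b: "b \<in> S" "gp_degree n (Q b)"
    using P by (rule gp_degree_Suc) blast
  define h where "h a u = L (gp_eval (Q a) u) (f u)" for a u
  define k where "k u = (\<Sum>a\<in>S - {b}. L (a * u) (h a u)) + L c (f u)" for u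
  have h: "\<exists>A. finite A \<and> mixed_poly r A (n + m) (h a)" for a
    unfolding h_def[abs_def] by (rule mixed_poly_gp_mult[OF Q f])
  then obtain B' where B': "finite B'" "mixed_poly r B' (n + m) (h b)" by blast
  have "mixed_poly r A (Suc (n + m)) (\<lambda>u. \<Sum>a\<in>A'. L (a * u) (h a u))" if "finite A'" "A' \<subseteq> A" for A A'
    using that
  proof (induction A' rule: finite_induct)
    case empty
    show ?case by (auto intro: mixed_poly_low degree_less_zero simp del: degree_less.simps)
  next
    case (insert a A')
    then show ?case using h[of a] by (auto intro!: mixed_poly.add intro: mixed_poly.left)
  qed
  from this[of "S - {b}" "S - {b}"]
  have k1: "mixed_poly r (S - {b}) (Suc (n + m)) (\<lambda>u. \<Sum>a\<in>S - {b}. L (a * u) (h a u))"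
    using S(1) by auto
  have "degree_less (Suc (n + m)) (\<lambda>u. L c (f u))"
    using degree_less_mono[OF _ mixed_poly_degree[OF f(2)], of "Suc (n + m)"]
    by (intro degree_less_compose[of "L c"]) (auto simp: L_add_right)
  then have k: "mixed_poly r (S - {b}) (Suc (n + m)) k"
    unfolding k_def[abs_def] by (rule mixed_poly.add[OF k1 mixed_poly_low])
  have "L (gp_eval P u) (f u) = L (b * u) (h b u) + k u" for u
    unfolding P' using sum.remove[OF S(1) b(1), of "\<lambda>a. L (a * u) (h a u)"]
    by (simp add: k_def h_def gp_eval_sum L_add_left sum_left L_mult add.assoc)
  then have "generic_degree_less N (Suc (n + m)) (\<lambda>u. L (b * u) (h b u) + k u)"
    using gv by simp
  from peel_left[OF inf N _ _ B'(1) _ B'(2) k this, of N']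
  have "generic_degree_less N' (n + m) (h b)"
    using sep S(1) center_basis_notin_span[OF b(1) S(2)] unfolding separates_def by blast
  then show ?thesis using b(2) unfolding h_def[abs_def] by blast
qed

text \<open>No variable stands on the right of the module element here, so peeling never enlarges
  \<open>N\<close>. All variables of \<open>P\<close> can be removed, until only a nonzero constant
  is left.\<close>

lemma generic_degree_gp_mult:
  assumes inf: "\<not> finite_dimensional_over_center TYPE('a)"
    and N: "subbimodule N" and f: "finite B" "mixed_poly False B m f"
    and "\<not> generic_degree_less N m f" and "gp_degree n P"
  shows "\<not> generic_degree_less N (n + m) (\<lambda>u. L (gp_eval P u) (f u))"
  using assms(6)
proof (induction n arbitrary: P)
  case 0
  then obtain c where c: "c \<noteq> 0" "P = gp_const c" by (rule gp_degree_0)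
  show ?case
  proof
    assume "generic_degree_less N (0 + m) (\<lambda>u. L (gp_eval P u) (f u))"
    then have "generic_degree_less N m (\<lambda>u. L (inverse c) (L c (f u)))"
      using c(2) subbimoduleD(3)[OF N]
      by (intro generic_degree_less_compose[of "L (inverse c)" N]) (auto simp: L_add_right)
    then show False using assms(5) c(1) by (simp add: L_mult[symmetric] L_one)
  qed
next
  case (Suc n)
  show ?case
  proof
    assume "generic_degree_less N (Suc n + m) (\<lambda>u. L (gp_eval P u) (f u))"
    from peel_gp[OF inf N separates_False[OF N] Suc.prems f this] show False
      using Suc.IH by blast
  qed
qed

end


section \<open>The functional identity\<close>

interpretation ring_bimodule: bimodule "(*)" "\<lambda>a v. v * (a :: 'a::division_ring)"
  by unfold_locales (simp_all add: algebra_simps)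

text \<open>The case of the constant map 1 in the bimodule \<open>D\<close>: the degree of a
  generalized polynomial as a formal object cannot drop when it is evaluated.\<close>

lemma gp_degree_nonvanishing:
  fixes P :: "'a::division_ring gen_poly"
  assumes "\<not> finite_dimensional_over_center TYPE('a)" "gp_degree n P"
  shows "\<not> generic_degree_less {0} n (gp_eval P)"
proof -
  have "ring_bimodule.subbimodule {0}" by (simp add: ring_bimodule.subbimodule_def)
  moreover have "ring_bimodule.mixed_poly False {} 0 (\<lambda>_. 1 :: 'a)"
    by (intro ring_bimodule.mixed_poly.right_poly ring_bimodule.right_poly.const)
  ultimately have "\<not> generic_degree_less {0} (n + 0) (\<lambda>u. gp_eval P u * 1)"
    using assms by (intro ring_bimodule.generic_degree_gp_mult[of _ "{}"]) auto
  then show ?thesis by simp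
qed

lemma ring_mixed_poly:
  assumes "gp_degree_less (Suc n) P"
  obtains A where "finite A" "ring_bimodule.mixed_poly False A n (\<lambda>u. d * gp_eval P u)"
proof -
  have "ring_bimodule.mixed_poly False {} 0 (\<lambda>_. 1 :: 'a)"
    by (intro ring_bimodule.mixed_poly.right_poly ring_bimodule.right_poly.const)
  then obtain A where A: "finite A"
      "ring_bimodule.mixed_poly False A (n + 0) (\<lambda>u. gp_eval (gp_const d * P) u * 1)"
    using ring_bimodule.mixed_poly_gp_mult[OF gp_degree_less_const_mult[OF assms] finite.emptyI] by blast
  from A(2) have "ring_bimodule.mixed_poly False A n (\<lambda>u. d * gp_eval P u)" by simp
  with A(1) show ?thesis by (rule that)
qed

text \<open>Inside \<open>D\<close> the factor \<open>d * gp_eval Q u\<close> is itself a polynomial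
  built by left multiplications. The right-hand polynomial is thus treated as the module element on
  which \<open>P\<close> acts.\<close>

lemma gp_sandwich_nonvanishing:
  fixes P Q :: "'a::division_ring gen_poly"
  assumes inf: "\<not> finite_dimensional_over_center TYPE('a)"
    and "gp_degree n P" "gp_degree m Q" "d \<noteq> 0"
  shows "\<not> generic_degree_less {0} (n + m) (\<lambda>u. gp_eval P u * (d * gp_eval Q u))"
proof -
  obtain A where A: "finite A" "ring_bimodule.mixed_poly False A m (\<lambda>u. d * gp_eval Q u)"
    using ring_mixed_poly[of m Q d] assms(3) unfolding gp_degree_def by blast
  have "\<not> generic_degree_less {0} m (\<lambda>u. d * gp_eval Q u)"
  proof
    assume "generic_degree_less {0} m (\<lambda>u. d * gp_eval Q u)"
    then have "generic_degree_less {0} m (\<lambda>u. inverse d * (d * gp_eval Q u))"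
      by (intro generic_degree_less_compose[of "(*) (inverse d)"]) (auto simp: distrib_left)
    then show False
      using gp_degree_nonvanishing[OF inf assms(3)] \<open>d \<noteq> 0\<close> by (simp add: mult.assoc[symmetric])
  qed
  then show ?thesis
    using A assms(2) inf
    by (intro ring_bimodule.generic_degree_gp_mult) (auto simp: ring_bimodule.subbimodule_def)
qed

lemma generic_degree_less_reflect:
  assumes "\<And>v w. h (v + w) = h v + (h w :: 'w::ab_group_add)" "\<And>v. h v \<in> N' \<Longrightarrow> v \<in> N"
    and "generic_degree_less N' n (\<lambda>u. h (f u :: 'v::ab_group_add))"
  shows "generic_degree_less N n f"
  using assms(3)
proof (induction n arbitrary: f)
  case 0
  then show ?case using assms(2) by simp
next
  case (Suc n)
  have "h (v - w) = h v - h w" for v w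
    using assms(1)[of "v - w" w] by simp
  then have "fdiff t (\<lambda>u. h (f u)) = (\<lambda>u. h (fdiff t f u))" for t
    by (simp add: fdiff_def)
  then obtain F where "finite F"
      "\<And>t. generic F t \<Longrightarrow> generic_degree_less N' n (\<lambda>u. h (fdiff t f u))"
    using Suc.prems by auto
  then show ?case using Suc.IH by auto
qed

context bimodule begin

lemma generic_degree_less_cong_mod:
  assumes N: "subbimodule N" and "\<And>u. f u - g u \<in> N" "generic_degree_less N n f"
  shows "generic_degree_less N n g"
  using assms(2,3)
proof (induction n arbitrary: f g)
  case 0
  have "f u - (f u - g u) \<in> N" for u
    by (rule subbimoduleD(6)[OF N]) (use 0 in auto)
  then show ?case by simp
next
  case (Suc n)
  have "fdiff t f u - fdiff t g u = (f (u + t) - g (u + t)) - (f u - g u)" for t u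
    by (simp add: fdiff_def algebra_simps)
  then have "fdiff t f u - fdiff t g u \<in> N" for t u
    using Suc.prems(1) subbimoduleD(6)[OF N] by simp
  moreover obtain F where "finite F" "\<And>t. generic F t \<Longrightarrow> generic_degree_less N n (fdiff t f)"
    using Suc.prems(2) by auto
  ultimately show ?case using Suc.IH by (metis generic_degree_less.simps(2))
qed

text \<open>\<open>C\<close> is chosen with as few elements as possible. A zero coefficient or a
  nontrivial relation modulo \<open>N\<close> would allow one of them to be removed.\<close>

lemma central_closure_minimal:
  assumes N: "subbimodule N" and v: "v \<in> central_closure N"
  obtains C d where "finite C" "\<And>c. c \<in> C \<Longrightarrow> central_mod N c" "v - (\<Sum>c\<in>C. L (d c) c) \<in> N"
    "\<And>c. c \<in> C \<Longrightarrow> d c \<noteq> 0"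
    "\<And>a c. (\<Sum>c\<in>C. L (a c) c) \<in> N \<Longrightarrow> c \<in> C \<Longrightarrow> a c = 0"
proof -
  define good where "good C d \<longleftrightarrow> finite C \<and> (\<forall>c\<in>C. central_mod N c) \<and> v - (\<Sum>c\<in>C. L (d c) c) \<in> N"
    for C d
  obtain C0 d0 where "good C0 d0"
    using v unfolding central_closure_def good_def by blast
  then have "\<exists>k C d. good C d \<and> card C = k" by blast
  define k where "k = (LEAST k. \<exists>C d. good C d \<and> card C = k)"
  obtain C d where C: "good C d" "card C = k"
    unfolding k_def using LeastI_ex[OF \<open>\<exists>k C d. good C d \<and> card C = k\<close>] by blast
  have min: "k \<le> card C'" if "good C' d'" for C' d'
    unfolding k_def using that by (intro Least_le) blast
  have fin: "finite C" using C(1) by (simp add: good_def)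
  have indep: "a c = 0" if a: "(\<Sum>c\<in>C. L (a c) c) \<in> N" and c: "c \<in> C" for a c
  proof (rule ccontr)
    assume "a c \<noteq> 0"
    \<comment> \<open>This multiple of the relation cancels the coefficient of \<open>c\<close> in
      the representation of \<open>v\<close>.\<close>
    define s where "s = d c * inverse (a c)"
    have "v - (\<Sum>x\<in>C. L (d x - s * a x) x) = (v - (\<Sum>x\<in>C. L (d x) x)) + L s (\<Sum>x\<in>C. L (a x) x)"
    proof -
      have "(\<Sum>x\<in>C. L (d x - s * a x) x) = (\<Sum>x\<in>C. L (d x) x) - L s (\<Sum>x\<in>C. L (a x) x)"
        unfolding sum L_mult[symmetric] sum_subtractf[symmetric]
        using L_add_left[of "d x - s * a x" "s * a x" x for x]
        by (intro sum.cong refl) (simp add: eq_diff_eq)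
      then show ?thesis by simp
    qed
    also have "\<dots> \<in> N"
      using C(1) a subbimoduleD(2,3)[OF N] unfolding good_def by blast
    also have "(\<Sum>x\<in>C. L (d x - s * a x) x) = (\<Sum>x\<in>C - {c}. L (d x - s * a x) x)"
      using sum.remove[OF fin c, of "\<lambda>x. L (d x - s * a x) x"] \<open>a c \<noteq> 0\<close>
      by (simp add: s_def mult.assoc)
    finally have "good (C - {c}) (\<lambda>x. d x - s * a x)"
      using C(1) by (simp add: good_def)
    then have "k \<le> card (C - {c})" by (rule min)
    moreover have "card (C - {c}) < card C" using c fin by (simp only: card_Diff1_less)
    ultimately show False using C(2) by simp
  qed
  have "d c \<noteq> 0" if c: "c \<in> C" for c
  proof
    assume "d c = 0"
    then have "(\<Sum>x\<in>C. L (d x) x) = (\<Sum>x\<in>C - {c}. L (d x) x)"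
      using sum.remove[OF fin c, of "\<lambda>x. L (d x) x"] by simp
    then have "good (C - {c}) d" using C(1) by (simp add: good_def)
    then have "k \<le> card (C - {c})" by (rule min)
    moreover have "card (C - {c}) < card C" using c fin by (simp only: card_Diff1_less)
    ultimately show False using C(2) by simp
  qed
  then show ?thesis using that[of C d] C(1) indep unfolding good_def by blast
qed

text \<open>Induction on the degree of \<open>P\<close>, for all \<open>N\<close> at once because
  peeling replaces \<open>N\<close> by \<open>central_closure N\<close>. The induction hypothesis
  then represents \<open>v\<close> modulo \<open>N\<close> by independent elements commuting with
  \<open>D\<close> modulo \<open>N\<close>, and each coefficient would satisfy an identity that
  \<open>gp_sandwich_nonvanishing\<close> excludes.\<close>

lemma functional_identity:
  assumes inf: "\<not> finite_dimensional_over_center TYPE('a)"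
    and "subbimodule N" "gp_degree n P" "gp_degree m Q"
    and "generic_degree_less N (n + m) (\<lambda>u. L (gp_eval P u) (R (gp_eval Q u) v))"
  shows "v \<in> N"
  using assms(2,3,5)
proof (induction n arbitrary: N P)
  case (0 N P)
  note N = 0(1)
  obtain c where c: "c \<noteq> 0" "P = gp_const c" using 0(2) by (rule gp_degree_0)
  show ?case
  proof (rule ccontr)
    assume v: "v \<notin> N"
    have "L (inverse c) (L c w) = w" for w
      using c(1) by (simp add: L_mult[symmetric] L_one)
    moreover have "generic_degree_less N m
        (\<lambda>u. L (inverse c) (L c (R (gp_eval Q u) v)))"
      using 0(3) c(2) subbimoduleD(3)[OF N]
      by (intro generic_degree_less_compose[of "L (inverse c)" N]) (auto simp: L_add_right)
    ultimately have "generic_degree_less N m (\<lambda>u. R (gp_eval Q u) v)" by simp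
    \<comment> \<open>A nonzero \<open>d\<close> could be cancelled, putting \<open>v\<close> into
      \<open>N\<close>. So membership of \<open>R d v\<close> in \<open>N\<close> detects vanishing
      of \<open>d\<close>, and the degree bound passes to \<open>Q\<close> itself.\<close>
    moreover have "d \<in> {0}" if "R d v \<in> N" for d
    proof (rule ccontr)
      assume "d \<notin> {0}"
      then have "R (inverse d) (R d v) = v" by (simp add: R_mult[symmetric] R_one)
      then show False using that v subbimoduleD(4)[OF N] by metis
    qed
    ultimately have "generic_degree_less {0} m (gp_eval Q)"
      by (intro generic_degree_less_reflect[of "\<lambda>d. R d v" N]) (auto simp: R_add_left)
    then show False using gp_degree_nonvanishing[OF inf assms(4)] by blast
  qed
next
  case (Suc n N P)
  note N = Suc.prems(1)
  have "right_poly True (0 + m) (\<lambda>u. R (gp_eval Q u) v)"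
    using assms(4) unfolding gp_degree_def by (intro right_poly_gp_mult right_poly.const) auto
  then have f: "mixed_poly True {} m (\<lambda>u. R (gp_eval Q u) v)"
    by (auto intro: mixed_poly.right_poly)
  obtain P' where "gp_degree n P'"
      "generic_degree_less (central_closure N) (n + m) (\<lambda>u. L (gp_eval P' u) (R (gp_eval Q u) v))"
    using peel_gp[OF inf N separates_True[OF N] Suc.prems(2) _ f Suc.prems(3)] by blast
  then have "v \<in> central_closure N"
    using Suc.IH subbimodule_central_closure[OF N] by blast
  then obtain C d where C: "finite C" "\<And>c. c \<in> C \<Longrightarrow> central_mod N c"
    and v: "v - (\<Sum>c\<in>C. L (d c) c) \<in> N" and d: "\<And>c. c \<in> C \<Longrightarrow> d c \<noteq> 0"
    and indep: "\<And>a c. (\<Sum>c\<in>C. L (a c) c) \<in> N \<Longrightarrow> c \<in> C \<Longrightarrow> a c = 0"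
    using central_closure_minimal[OF N] by blast
  have "C = {}"
  proof (rule ccontr)
    assume "C \<noteq> {}"
    then obtain c where c: "c \<in> C" by blast
    \<comment> \<open>One difference calculus in \<open>'v \<Rightarrow> 'a\<close> reads off all coefficients at once.\<close>
    define F where "F u = (\<lambda>x. gp_eval P u * (d x * gp_eval Q u))" for u
    \<comment> \<open>Modulo \<open>N\<close> the value of \<open>Q\<close> passes from the right of
      each \<open>x\<close> to its left, so the identity becomes one for left coefficients.\<close>
    have "L (gp_eval P u) (R (gp_eval Q u) v) - (\<Sum>x\<in>C. L (F u x) x) \<in> N" for u
    proof -
      let ?p = "gp_eval P u" and ?q = "gp_eval Q u"
      have "L ?p (R ?q v) - (\<Sum>x\<in>C. L (F u x) x)
        = L ?p (R ?q (v - (\<Sum>x\<in>C. L (d x) x))) - (\<Sum>x\<in>C. L (?p * d x) (L ?q x - R ?q x))"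
        by (simp add: F_def diff sum L_mult L_R sum_subtractf)
      moreover have "(\<Sum>x\<in>C. L (?p * d x) (L ?q x - R ?q x)) \<in> N"
        using C(2) by (intro subbimodule_sum[OF N] subbimoduleD(3)[OF N]) (auto simp: central_mod_def)
      ultimately show ?thesis using v subbimoduleD[OF N] by simp
    qed
    then have "generic_degree_less N (Suc n + m) (\<lambda>u. \<Sum>x\<in>C. L (F u x) x)"
      using Suc.prems(3) by (rule generic_degree_less_cong_mod[OF N])
    then have "generic_degree_less {\<phi>. \<phi> c = 0} (Suc n + m) F"
      using indep c
      by (intro generic_degree_less_reflect[of "\<lambda>\<phi>. \<Sum>x\<in>C. L (\<phi> x) x" N])
        (auto simp: L_add_left sum.distrib)
    then have "generic_degree_less {0} (Suc n + m) (\<lambda>u. F u c)"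
      by (rule generic_degree_less_compose[where h = "\<lambda>\<phi>. \<phi> c", rotated 2]) auto
    then show False
      using gp_sandwich_nonvanishing[OF inf Suc.prems(2) assms(4) d[OF c]] by (simp add: F_def)
  qed
  then show ?case using v by simp
qed

end

section \<open>Maps from \<open>D\<close> to \<open>D\<close> modulo generalized polynomial
  maps\<close>

interpretation function_bimodule: bimodule
  "\<lambda>(a :: 'a::division_ring) (f :: 'a \<Rightarrow> 'a) x. a * f x" "\<lambda>a f x. f x * a"
  by unfold_locales (auto simp: fun_eq_iff algebra_simps)

lemma subbimodule_range_gp_eval: "function_bimodule.subbimodule (range gp_eval)"
  unfolding function_bimodule.subbimodule_def
proof (intro conjI ballI allI)
  show "0 \<in> range gp_eval" by (rule image_eqI[of _ _ 0]) auto
next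
  fix f g :: "'a \<Rightarrow> 'a"
  assume "f \<in> range gp_eval" "g \<in> range gp_eval"
  then obtain P Q where "f = gp_eval P" "g = gp_eval Q" by blast
  then show "f + g \<in> range gp_eval" by (intro image_eqI[of _ _ "P + Q"]) auto
next
  fix a :: 'a and f :: "'a \<Rightarrow> 'a"
  assume "f \<in> range gp_eval"
  then obtain P where P: "f = gp_eval P" by blast
  show "(\<lambda>x. a * f x) \<in> range gp_eval"
    by (rule image_eqI[of _ _ "gp_const a * P"]) (auto simp: P)
  show "(\<lambda>x. f x * a) \<in> range gp_eval"
    by (rule image_eqI[of _ _ "P * gp_const a"]) (auto simp: P)
qed

lemma gp_eval_diff: "gp_eval (P - Q) y = gp_eval P y - gp_eval Q y"
  by (simp only: minus_gen_poly_def gp_eval_simps diff_conv_add_uminus)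

lemma gp_shift: "\<exists>Q. \<forall>y. gp_eval Q y = gp_eval P (y + u)"
proof (induction P)
  case (const a)
  show ?case by (rule exI[of _ "gp_const a"]) simp
next
  case var
  show ?case by (rule exI[of _ "gp_var + gp_const u"]) simp
next
  case (add P Q)
  then obtain P' Q' where "\<And>y. gp_eval P' y = gp_eval P (y + u)" "\<And>y. gp_eval Q' y = gp_eval Q (y + u)"
    by blast
  then show ?case by (intro exI[of _ "P' + Q'"]) simp
next
  case (mult P Q)
  then obtain P' Q' where "\<And>y. gp_eval P' y = gp_eval P (y + u)" "\<And>y. gp_eval Q' y = gp_eval Q (y + u)"
    by blast
  then show ?case by (intro exI[of _ "P' * Q'"]) simp
next
  case (uminus P)
  then obtain P' where "\<And>y. gp_eval P' y = gp_eval P (y + u)" by blast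
  then show ?case by (intro exI[of _ "- P'"]) simp
qed

lemma generic_degree_less_fold:
  assumes "\<And>ts u. length ts = n \<Longrightarrow> fold fdiff ts f u \<in> N"
  shows "generic_degree_less N n f"
  using assms
proof (induction n arbitrary: f)
  case 0
  then show ?case using 0[of "[]"] by simp
next
  case (Suc n)
  have "generic_degree_less N n (fdiff t f)" for t
    using Suc.prems[of "t # ts" for ts] by (intro Suc.IH) simp
  then show ?case by (auto intro!: exI[of _ "{}"])
qed

lemma generic_degree_lessI: "degree_less n f \<Longrightarrow> 0 \<in> N \<Longrightarrow> generic_degree_less N n f"
  by (induction n arbitrary: f) auto

lemma degree_less_fold: "degree_less (n + length ts) f \<Longrightarrow> degree_less n (fold fdiff ts f)"
  by (induction ts arbitrary: f) auto

lemma fold_fdiff_shift: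
  "fold fdiff ts (\<lambda>u. f (u + s)) = (\<lambda>u. fold fdiff ts f (u + (s :: 'a::ab_semigroup_add)))"
  by (induction ts arbitrary: f) (auto simp: fdiff_shift)

lemma fold_fdiff_apply: "fold fdiff ts f u y = fold fdiff ts (\<lambda>u. f u y) u"
proof (induction ts arbitrary: f)
  case (Cons t ts)
  have "(\<lambda>u. fdiff t f u y) = fdiff t (\<lambda>u. f u y)" by (simp add: fdiff_def)
  with Cons show ?case by simp
qed simp

lemma (in bimodule) fold_fdiff_subbimodule:
  assumes "subbimodule N" "\<And>u. f u \<in> N"
  shows "fold fdiff ts f u \<in> N"
  using assms(2)
proof (induction ts arbitrary: f)
  case (Cons t ts)
  have "fdiff t f u \<in> N" for u
    unfolding fdiff_def using Cons.prems subbimoduleD(6)[OF assms(1)] by blast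
  with Cons.IH show ?case by simp
qed simp

text \<open>Differences of an additive map are constant, so its degree is less than 2. Since
  evaluation does not lower the degree, \<open>P\<close> can be written with at most one variable
  per monomial, and the value at 0 removes the constant term.\<close>

lemma additive_gp_eval_elementary:
  fixes P :: "'a::division_ring gen_poly"
  assumes inf: "\<not> finite_dimensional_over_center TYPE('a)"
    and "additive (gp_eval P)"
  shows "elementary_operator (gp_eval P)"
proof -
  interpret additive "gp_eval P" by (rule assms(2))
  have deg: "degree_less 2 (gp_eval P)"
    by (simp add: numeral_2_eq_2 fdiff_def add)
  have "gp_degree_less 2 P"
  proof (rule ccontr)
    assume P: "\<not> gp_degree_less 2 P"
    then have "P \<noteq> 0" using gp_degree_less.zero by blast
    then obtain n where n: "gp_degree n P" using gp_degree_exists by blast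
    then have "2 \<le> n"
      using P gp_degree_less_mono[of "Suc n" 2 P] unfolding gp_degree_def by (meson not_less_eq_eq)
    then have "generic_degree_less {0} n (gp_eval P)"
      using degree_less_mono[OF _ deg] by (intro generic_degree_lessI) auto
    then show False using gp_degree_nonvanishing[OF inf n] by simp
  qed
  then obtain S Q c where S: "finite S" "\<And>b. gp_degree_less (Suc 0) (Q b)"
      "P = (\<Sum>b\<in>S. gp_const b * gp_var * Q b) + gp_const c"
    using gp_expansion[of "Suc 0" P] by (auto simp: numeral_2_eq_2)
  have "\<exists>q. Q b = gp_const q" for b
  proof -
    obtain S' Q' c' where Q': "\<And>b. gp_degree_less 0 (Q' b)"
        "Q b = (\<Sum>b\<in>S'. gp_const b * gp_var * Q' b) + gp_const c'"
      using gp_expansion[OF S(2)] by blast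
    have "Q b = gp_const c'" unfolding Q'(2) using gp_degree_less_0[OF Q'(1)] by simp
    then show ?thesis ..
  qed
  then obtain q where "\<And>b. Q b = gp_const (q b)" by metis
  then have P: "gp_eval P y = (\<Sum>b\<in>S. b * y * q b) + c" for y
    by (simp add: S(3) gp_eval_sum)
  have "c = 0" using P[of 0] zero by simp
  then have "gp_eval P = (\<lambda>y. \<Sum>b\<in>S. b * y * q b)" using P by auto
  then show ?thesis using elementary_operatorI[OF S(1)] by simp
qed

theorem theorem1p5:
  fixes g :: "'a::division_ring \<Rightarrow> 'a"
    and G1 G2 H :: "'a gen_poly"
  assumes "additive g"
    and "\<And>y. gp_eval G1 y * g y * gp_eval G2 y = gp_eval H y"
    and "G1 \<noteq> 0" and "G2 \<noteq> 0"
  shows "elementary_operator g \<or> finite_dimensional_over_center TYPE('a)"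
proof (rule disjCI)
  assume inf: "\<not> finite_dimensional_over_center TYPE('a)"
  obtain n where n: "gp_degree n G1" using gp_degree_exists assms(3) by blast
  obtain m where m: "gp_degree m G2" using gp_degree_exists assms(4) by blast
  define \<Phi> where "\<Phi> u = (\<lambda>y. gp_eval G1 u * (g y * gp_eval G2 u))" for u
  \<comment> \<open>\<open>\<Psi> u y\<close> is \<open>\<Phi> (u + y) y\<close>. The hypothesis at
    \<open>y + u\<close> shows that \<open>\<Psi> u\<close> is a generalized polynomial map, because
    \<open>g (y + u)\<close> splits into \<open>g y\<close> and the constant
    \<open>g u\<close>.\<close>
  define \<Psi> where "\<Psi> u = (\<lambda>y. gp_eval G1 (u + y) * (g y * gp_eval G2 (u + y)))" for u
  have \<Psi>: "\<Psi> u \<in> range gp_eval" for u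
  proof -
    obtain G1' G2' H' where sh: "\<And>y. gp_eval G1' y = gp_eval G1 (y + u)"
      "\<And>y. gp_eval G2' y = gp_eval G2 (y + u)" "\<And>y. gp_eval H' y = gp_eval H (y + u)"
      using gp_shift by metis
    have "\<Psi> u y = gp_eval (H' - G1' * gp_const (g u) * G2') y" for y
    proof -
      have "gp_eval H (y + u) = gp_eval G1 (y + u) * (g y + g u) * gp_eval G2 (y + u)"
        using assms(2)[of "y + u"] additive.add[OF assms(1), of y u] by simp
      then show ?thesis
        by (simp add: \<Psi>_def sh gp_eval_diff add.commute[of u y] distrib_left distrib_right mult.assoc)
    qed
    then show ?thesis by blast
  qed
  have "generic_degree_less (range gp_eval) (n + m) \<Phi>"
  proof (rule generic_degree_less_fold)
    fix ts :: "'a list" and u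
    assume ts: "length ts = n + m"
    \<comment> \<open>For fixed \<open>y\<close>, \<open>\<Phi> u y\<close> has degree at most
      \<open>n + m\<close> in \<open>u\<close>. After \<open>n + m\<close> differences it is
      constant, so the translation of \<open>u\<close> by \<open>y\<close> makes no
      difference.\<close>
    have "fold fdiff ts \<Phi> u y = fold fdiff ts \<Psi> u y" for y
    proof -
      obtain A where "finite A" "ring_bimodule.mixed_poly False A m (\<lambda>u. g y * gp_eval G2 u)"
        using ring_mixed_poly[of m G2 "g y"] m unfolding gp_degree_def by blast
      then obtain B where "ring_bimodule.mixed_poly False B (n + m) (\<lambda>u. \<Phi> u y)"
        unfolding \<Phi>_def
        using ring_bimodule.mixed_poly_gp_mult[of n G1] n unfolding gp_degree_def by blast
      then have "degree_less (Suc 0 + length ts) (\<lambda>u. \<Phi> u y)"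
        using ring_bimodule.mixed_poly_degree ts by (metis plus_1_eq_Suc One_nat_def)
      then have "degree_less (Suc 0) (fold fdiff ts (\<lambda>u. \<Phi> u y))"
        by (rule degree_less_fold)
      then have const: "fold fdiff ts (\<lambda>u. \<Phi> u y) x = fold fdiff ts (\<lambda>u. \<Phi> u y) 0" for x
        using degree_less_1_const by blast
      have "fold fdiff ts \<Psi> u y = fold fdiff ts (\<lambda>u. \<Phi> (u + y) y) u"
        unfolding fold_fdiff_apply by (simp add: \<Phi>_def \<Psi>_def)
      also have "\<dots> = fold fdiff ts (\<lambda>u. \<Phi> u y) (u + y)"
        by (simp add: fold_fdiff_shift[of ts "\<lambda>u. \<Phi> u y"])
      finally show ?thesis
        unfolding fold_fdiff_apply[of ts \<Phi>] using const[of u] const[of "u + y"] by simp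
    qed
    then have "fold fdiff ts \<Phi> u = fold fdiff ts \<Psi> u" by blast
    moreover have "fold fdiff ts \<Psi> u \<in> range gp_eval"
      by (rule function_bimodule.fold_fdiff_subbimodule[OF subbimodule_range_gp_eval \<Psi>])
    ultimately show "fold fdiff ts \<Phi> u \<in> range gp_eval" by simp
  qed
  then have "g \<in> range gp_eval"
    unfolding \<Phi>_def
    by (rule function_bimodule.functional_identity[OF inf subbimodule_range_gp_eval n m])
  then show "elementary_operator g"
    using additive_gp_eval_elementary[OF inf] assms(1) by blast
qed

end
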